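(* Let $D$ be a presymplectic double groupoid with closed $2$-form $\omega$. Then the closed $2$-form $\Omega=\nu^*\omega$ on $\overline{W}_2ND$ is multiplicative, i.e. $\sum_{i=0}^3(-1)^i(f_i^3)^*\Omega=0$ on $\overline{W}_3ND$, where $f_i^3:\overline{W}_3ND\to\overline{W}_2ND$ are the face maps and $\nu:\overline{W}_2ND\to D$ is the natural map.
   Context: Notation: $A\times_{f,g}B=\{(a,b): f(a)=g(b)\}$. In any groupoid the product $a\cdot b$ is defined when $s(a)=t(b)$. Double Lie groupoid. It consists of manifolds $D,V,H,M$ and Lie groupoid structures $V\rightrightarrows M$ and $H\rightrightarrows M$ (source and target both denoted $s,t$), $D\rightrightarrows H$ (source and target $s_H,t_H$, product $\cdot_H:D\times_{s_H,t_H}D\to D$) and $D\rightrightarrows V$ (source and target $s_V,t_V$, product $\cdot_V:D\times_{s_V,t_V}D\to D$) such that: (1) $s\circ s_H=s\circ s_V$, $t\circ t_H=t\circ t_V$, $t\circ s_H=s\circ t_V$, $s\circ t_H=t\circ s_V$. (2) $s_V(\alpha_1\cdot_H\alpha_2)=s_V\alpha_1\cdot s_V\alpha_2$, $t_V(\alpha_1\cdot_H\alpha_2)=t_V\alpha_1\cdot t_V\alpha_2$, $s_H(\alpha_1\cdot_V\alpha_3)=s_H\alpha_1\cdot s_H\alpha_3$, $t_H(\alpha_1\cdot_V\alpha_3)=t_H\alpha_1\cdot t_H\alpha_3$ whenever $s_H\alpha_1=t_H\alpha_2$, $s_V\alpha_1=t_V\alpha_3$. (3) Interchange law: $(\alpha_{11}\cdot_H\alpha_{12})\cdot_V(\alpha_{21}\cdot_H\alpha_{22})=(\alpha_{11}\cdot_V\alpha_{21})\cdot_H(\alpha_{12}\cdot_V\alpha_{22})$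 whenever $s_H(\alpha_{i1})=t_H(\alpha_{i2})$ and $s_V(\alpha_{1i})=t_V(\alpha_{2i})$ for $i=1,2$. (4) The double-source map $(s_V,s_H):D\to V\times_{s,s}H$ is a submersion. A $2$-form $\omega$ on the arrow manifold of a Lie groupoid with multiplication $m$ is multiplicative if $m^*\omega=\mathrm{pr}_1^*\omega+\mathrm{pr}_2^*\omega$ on composable pairs. A presymplectic double groupoid is a double Lie groupoid $D$ with a closed $2$-form $\omega$ on $D$ that is multiplicative for both $D\rightrightarrows V$ and $D\rightrightarrows H$. Bisimplicial manifold: a family of manifolds $X_{p,q}$ with vertical face and degeneracy maps $v_i:X_{p,q}\to X_{p,q-1}$, $\mu_i:X_{p,q}\to X_{p,q+1}$ $(0\le i\le q)$ and horizontal ones $h_i:X_{p,q}\to X_{p-1,q}$, $\eta_i:X_{p,q}\to X_{p+1,q}$ $(0\le i\le p)$, such that faces are surjective submersions, degeneracies are embeddings, the usual simplicial identities hold in each direction, and horizontal maps commute with vertical maps. Nerve of a Lie groupoid $G\rightrightarrows M$: $N_0G=M$, $N_pG$ is the space of composable $p$-tuples $(g_1,\dots,g_p)$, $s(g_i)=t(g_{i+1})$; for $p\ge2$, $f_0$ drops $g_1$, $f_p$ drops $g_p$, $f_i$ $(0<i<p)$ multiplies $g_i\cdot g_{i+1}$; for $p=1$, $f_0=s$, $f_1=t$; $\delta_i$ inserts a unit after $g_i$ (before $g_1$ when $i=0$). Nerve of $D$: $N_{0,0}D=M$; $N_{0,q}D=V^{(q)}$ and $N_{p,0}D=H^{(p)}$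 (composable tuples in $V$, $H$); for $p,q>0$, $N_{p,q}D$ is the space of arrays $\{\alpha_{ij}\}_{1\le i\le p,1\le j\le q}$ in $D$ with $s_H(\alpha_{ij})=t_H(\alpha_{i(j+1)})$ and $s_V(\alpha_{ij})=t_V(\alpha_{(i+1)j})$. The horizontal structure maps on $N_{\bullet,q}D$ are those of the nerve of the Lie groupoid $D_H^{(q)}\rightrightarrows V^{(q)}$ of $\cdot_H$-composable $q$-tuples with componentwise structure from $D\rightrightarrows V$ (for $q=0$: $H\rightrightarrows M$); the vertical ones on $N_{p,\bullet}D$ are those of the nerve of the Lie groupoid $D_V^{(p)}\rightrightarrows H^{(p)}$ of $\cdot_V$-composable $p$-tuples with componentwise structure from $D\rightrightarrows H$ (for $p=0$: $V\rightrightarrows M$). Bar construction: $\overline{W}_rX$ is the manifold of tuples $(x_0,\dots,x_r)$, $x_i\in X_{i,r-i}$, with $v_0(x_i)=h_{i+1}(x_{i+1})$ for $0\le i<r$, with face maps $f_i^r(x_0,\dots,x_r)=(v_i(x_0),v_{i-1}(x_1),\dots,v_1(x_{i-1}),h_i(x_{i+1}),\dots,h_i(x_r))$ and degeneracy maps $\delta_i^r(x_0,\dots,x_r)=(\mu_i(x_0),\dots,\mu_0(x_i),\eta_i(x_i),\dots,\eta_i(x_r))$. With $s^2=s\circ s_V=s\circ s_H$ and $t^2=t\circ t_V=t\circ t_H$, one has $\overline{W}_2ND\cong V\times_{s,t^2}D\times_{s^2,t}H$, and the natural map is $\nu(\theta,\alpha,\eta)=\alpha$. *)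

theory Defs
  imports "HOL-Analysis.Analysis"
begin

section \<open>Smooth maps between subsets of Euclidean spaces\<close>

primrec Ck_on :: "nat \<Rightarrow> 'a::real_normed_vector set \<Rightarrow> ('a \<Rightarrow> 'b::real_normed_vector) \<Rightarrow> bool" where
  "Ck_on 0 W f \<longleftrightarrow> continuous_on W f"
| "Ck_on (Suc k) W f \<longleftrightarrow> (\<forall>x\<in>W. f differentiable (at x)) \<and>
     (\<forall>v. Ck_on k W (\<lambda>x. frechet_derivative f (at x) v))"

text \<open>On an arbitrary subset, smoothness means local extendability to a smooth map on an open set.
  On a relatively open subset of a linear subspace this is ordinary smoothness, and on an
  embedded submanifold it is smoothness for the submanifold structure.\<close>

definition smooth_on :: "'a::euclidean_space set \<Rightarrow> ('a \<Rightarrow> 'b::euclidean_space) \<Rightarrow> bool" where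
  "smooth_on A f \<longleftrightarrow> (\<forall>x\<in>A. \<exists>W F. open W \<and> x \<in> W \<and> (\<forall>k. Ck_on k W F) \<and> (\<forall>y\<in>A \<inter> W. F y = f y))"


section \<open>Smooth spaces and manifolds\<close>

text \<open>A smooth space carries an atlas whose charts are homeomorphisms onto \<^emph>\<open>arbitrary\<close> subsets
  of a Euclidean space, with smooth transition maps. Products and subsets of smooth spaces are
  smooth spaces, so fibre products carry a canonical structure; on an embedded submanifold of a
  manifold it is the submanifold structure. A manifold is a Hausdorff, second countable smooth
  space that is locally diffeomorphic to open subsets of a linear subspace \<open>E\<close> of the chart space;
  its dimension is \<open>dim E\<close>, which may be \<open>0\<close>.\<close>

record ('a, 'e) smooth_space =
  topol :: "'a topology"
  charts :: "('a set \<times> ('a \<Rightarrow> 'e)) set"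

abbreviation points :: "('a, 'e) smooth_space \<Rightarrow> 'a set" where
  "points X \<equiv> topspace (topol X)"

definition smooth_space :: "('a, 'e::euclidean_space) smooth_space \<Rightarrow> bool" where
  "smooth_space X \<longleftrightarrow>
     (\<forall>(U, \<phi>)\<in>charts X. openin (topol X) U \<and>
        homeomorphic_map (subtopology (topol X) U) (top_of_set (\<phi> ` U)) \<phi>) \<and>
     points X = (\<Union>(U, \<phi>)\<in>charts X. U) \<and>
     (\<forall>(U, \<phi>)\<in>charts X. \<forall>(V, \<psi>)\<in>charts X. smooth_on (\<phi> ` (U \<inter> V)) (\<psi> \<circ> inv_into U \<phi>))"

definition smooth_map ::
  "('a, 'e::euclidean_space) smooth_space \<Rightarrow> ('b, 'f::euclidean_space) smooth_space \<Rightarrow> ('a \<Rightarrow> 'b) \<Rightarrow> bool" where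
  "smooth_map X Y f \<longleftrightarrow> continuous_map (topol X) (topol Y) f \<and>
     (\<forall>(U, \<phi>)\<in>charts X. \<forall>(V, \<psi>)\<in>charts Y.
        smooth_on (\<phi> ` (U \<inter> f -` V)) (\<psi> \<circ> f \<circ> inv_into U \<phi>))"

definition euclidean_subset :: "'e::euclidean_space set \<Rightarrow> ('e, 'e) smooth_space" where
  "euclidean_subset A = \<lparr>topol = top_of_set A, charts = {(A, id)}\<rparr>"

definition sub_space :: "('a, 'e) smooth_space \<Rightarrow> 'a set \<Rightarrow> ('a, 'e) smooth_space" where
  "sub_space X S = \<lparr>topol = subtopology (topol X) S, charts = {(U \<inter> S, \<phi>) |U \<phi>. (U, \<phi>) \<in> charts X}\<rparr>"

definition prod_space ::
  "('a, 'e) smooth_space \<Rightarrow> ('b, 'f) smooth_space \<Rightarrow> ('a \<times> 'b, 'e \<times> 'f) smooth_space" where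
  "prod_space X Y = \<lparr>topol = prod_topology (topol X) (topol Y),
     charts = {(U \<times> V, map_prod \<phi> \<psi>) |U \<phi> V \<psi>. (U, \<phi>) \<in> charts X \<and> (V, \<psi>) \<in> charts Y}\<rparr>"

definition manifold_chart ::
  "('a, 'e::euclidean_space) smooth_space \<Rightarrow> 'e set \<Rightarrow> 'a set \<Rightarrow> ('a \<Rightarrow> 'e) \<Rightarrow> bool" where
  "manifold_chart X E U \<phi> \<longleftrightarrow> subspace E \<and> openin (topol X) U \<and>
     inj_on \<phi> U \<and> openin (top_of_set E) (\<phi> ` U) \<and>
     smooth_map (sub_space X U) (euclidean_subset (\<phi> ` U)) \<phi> \<and>
     smooth_map (euclidean_subset (\<phi> ` U)) (sub_space X U) (inv_into U \<phi>)"

definition manifold :: "('a, 'e::euclidean_space) smooth_space \<Rightarrow> bool" where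
  "manifold X \<longleftrightarrow> smooth_space X \<and> Hausdorff_space (topol X) \<and> second_countable (topol X) \<and>
     (\<exists>E. \<forall>x\<in>points X. \<exists>U \<phi>. x \<in> U \<and> manifold_chart X E U \<phi>)"


section \<open>Tangent vectors and differential 2-forms\<close>

definition smooth_functions :: "('a, 'e::euclidean_space) smooth_space \<Rightarrow> ('a \<Rightarrow> real) set" where
  "smooth_functions X = {g. smooth_map X (euclidean_subset UNIV) g}"

text \<open>Tangent vectors are derivations of the algebra of smooth functions. They are functions on all
  of \<open>'a \<Rightarrow> real\<close>, fixed to vanish outside that algebra.\<close>

type_synonym 'a tangent = "('a \<Rightarrow> real) \<Rightarrow> real"

definition tangent_space :: "('a, 'e::euclidean_space) smooth_space \<Rightarrow> 'a \<Rightarrow> 'a tangent set" where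
  "tangent_space X x = {u.
     (\<forall>g\<in>smooth_functions X. \<forall>h\<in>smooth_functions X. u (\<lambda>y. g y + h y) = u g + u h) \<and>
     (\<forall>c. \<forall>g\<in>smooth_functions X. u (\<lambda>y. c * g y) = c * u g) \<and>
     (\<forall>g\<in>smooth_functions X. \<forall>h\<in>smooth_functions X. u (\<lambda>y. g y * h y) = g x * u h + h x * u g) \<and>
     (\<forall>g. g \<notin> smooth_functions X \<longrightarrow> u g = 0)}"

definition pushforward :: "('b, 'f::euclidean_space) smooth_space \<Rightarrow> ('a \<Rightarrow> 'b) \<Rightarrow> 'a tangent \<Rightarrow> 'b tangent" where
  "pushforward Y f u = (\<lambda>g. if g \<in> smooth_functions Y then u (g \<circ> f) else 0)"

definition submersion ::
  "('a, 'e::euclidean_space) smooth_space \<Rightarrow> ('b, 'f::euclidean_space) smooth_space \<Rightarrow> ('a \<Rightarrow> 'b) \<Rightarrow> bool" where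
  "submersion X Y f \<longleftrightarrow> smooth_map X Y f \<and>
     (\<forall>x\<in>points X. tangent_space Y (f x) \<subseteq> pushforward Y f ` tangent_space X x)"

definition dir_deriv :: "('e::real_vector \<Rightarrow> real) \<Rightarrow> 'e \<Rightarrow> 'e \<Rightarrow> real" where
  "dir_deriv g y e = deriv (\<lambda>r. g (y + r *\<^sub>R e)) 0"

definition coord_vector ::
  "('a, 'e::euclidean_space) smooth_space \<Rightarrow> 'a set \<Rightarrow> ('a \<Rightarrow> 'e) \<Rightarrow> 'a \<Rightarrow> 'e \<Rightarrow> 'a tangent" where
  "coord_vector X U \<phi> x e =
     (\<lambda>g. if g \<in> smooth_functions X then dir_deriv (g \<circ> inv_into U \<phi>) (\<phi> x) e else 0)"

type_synonym 'a two_form = "'a \<Rightarrow> 'a tangent \<Rightarrow> 'a tangent \<Rightarrow> real"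

definition coord_coeff ::
  "('a, 'e::euclidean_space) smooth_space \<Rightarrow> 'a set \<Rightarrow> ('a \<Rightarrow> 'e) \<Rightarrow> 'a two_form \<Rightarrow> 'e \<Rightarrow> 'e \<Rightarrow> 'e \<Rightarrow> real" where
  "coord_coeff X U \<phi> \<omega> e1 e2 = (\<lambda>y. let x = inv_into U \<phi> y in
     \<omega> x (coord_vector X U \<phi> x e1) (coord_vector X U \<phi> x e2))"

definition two_form :: "('a, 'e::euclidean_space) smooth_space \<Rightarrow> 'a two_form \<Rightarrow> bool" where
  "two_form X \<omega> \<longleftrightarrow>
     (\<forall>x\<in>points X. \<forall>u\<in>tangent_space X x.
        \<omega> x u u = 0 \<and>
        (\<forall>v\<in>tangent_space X x. \<forall>w\<in>tangent_space X x.
           \<omega> x (\<lambda>g. u g + v g) w = \<omega> x u w + \<omega> x v w \<and>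
           \<omega> x w (\<lambda>g. u g + v g) = \<omega> x w u + \<omega> x w v) \<and>
        (\<forall>c. \<forall>w\<in>tangent_space X x.
           \<omega> x (\<lambda>g. c * u g) w = c * \<omega> x u w \<and> \<omega> x w (\<lambda>g. c * u g) = c * \<omega> x w u)) \<and>
     (\<forall>E U \<phi>. manifold_chart X E U \<phi> \<longrightarrow>
        (\<forall>e1\<in>E. \<forall>e2\<in>E. smooth_on (\<phi> ` U) (coord_coeff X U \<phi> \<omega> e1 e2)))"

text \<open>The summed expression is \<open>d\<omega>(e1, e2, e3)\<close> for constant coordinate vector fields.\<close>

definition closed_two_form :: "('a, 'e::euclidean_space) smooth_space \<Rightarrow> 'a two_form \<Rightarrow> bool" where
  "closed_two_form X \<omega> \<longleftrightarrow> two_form X \<omega> \<and>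
     (\<forall>E U \<phi>. manifold_chart X E U \<phi> \<longrightarrow>
        (\<forall>e1\<in>E. \<forall>e2\<in>E. \<forall>e3\<in>E. \<forall>y\<in>\<phi> ` U.
           dir_deriv (coord_coeff X U \<phi> \<omega> e2 e3) y e1
           - dir_deriv (coord_coeff X U \<phi> \<omega> e1 e3) y e2
           + dir_deriv (coord_coeff X U \<phi> \<omega> e1 e2) y e3 = 0))"

definition pullback :: "('b, 'f::euclidean_space) smooth_space \<Rightarrow> ('a \<Rightarrow> 'b) \<Rightarrow> 'b two_form \<Rightarrow> 'a two_form" where
  "pullback Y f \<omega> = (\<lambda>x u v. \<omega> (f x) (pushforward Y f u) (pushforward Y f v))"


section \<open>Lie groupoids\<close>

record ('g, 'ge, 'm, 'me) groupoid =
  arrows :: "('g, 'ge) smooth_space"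
  objects :: "('m, 'me) smooth_space"
  src :: "'g \<Rightarrow> 'm"
  tgt :: "'g \<Rightarrow> 'm"
  mul :: "'g \<Rightarrow> 'g \<Rightarrow> 'g"
  unit_at :: "'m \<Rightarrow> 'g"
  inverse_arrow :: "'g \<Rightarrow> 'g"

text \<open>Levels 2 and 3 of the nerve (composable pairs and triples), and its face maps out of
  levels 1, 2 and 3. A face index beyond the level is read as the last one.\<close>

definition nerve2 :: "('g, 'ge, 'm, 'me) groupoid \<Rightarrow> ('g \<times> 'g, 'ge \<times> 'ge) smooth_space" where
  "nerve2 G = sub_space (prod_space (arrows G) (arrows G)) {(a, b). src G a = tgt G b}"

definition nerve3 :: "('g, 'ge, 'm, 'me) groupoid \<Rightarrow> ('g \<times> 'g \<times> 'g, 'ge \<times> 'ge \<times> 'ge) smooth_space" where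
  "nerve3 G = sub_space (prod_space (arrows G) (prod_space (arrows G) (arrows G)))
     {(a, b, c). src G a = tgt G b \<and> src G b = tgt G c}"

definition nerve_face1 :: "('g, 'ge, 'm, 'me) groupoid \<Rightarrow> nat \<Rightarrow> 'g \<Rightarrow> 'm" where
  "nerve_face1 G i a = (if i = 0 then src G a else tgt G a)"

definition nerve_face2 :: "('g, 'ge, 'm, 'me) groupoid \<Rightarrow> nat \<Rightarrow> 'g \<times> 'g \<Rightarrow> 'g" where
  "nerve_face2 G i = (\<lambda>(a, b). if i = 0 then b else if i = 1 then mul G a b else a)"

definition nerve_face3 :: "('g, 'ge, 'm, 'me) groupoid \<Rightarrow> nat \<Rightarrow> 'g \<times> 'g \<times> 'g \<Rightarrow> 'g \<times> 'g" where
  "nerve_face3 G i = (\<lambda>(a, b, c). if i = 0 then (b, c) else if i = 1 then (mul G a b, c)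
     else if i = 2 then (a, mul G b c) else (a, b))"

definition lie_groupoid :: "('g, 'ge::euclidean_space, 'm, 'me::euclidean_space) groupoid \<Rightarrow> bool" where
  "lie_groupoid G \<longleftrightarrow>
     manifold (arrows G) \<and> manifold (objects G) \<and>
     submersion (arrows G) (objects G) (src G) \<and> submersion (arrows G) (objects G) (tgt G) \<and>
     smooth_map (nerve2 G) (arrows G) (\<lambda>(a, b). mul G a b) \<and>
     smooth_map (objects G) (arrows G) (unit_at G) \<and>
     smooth_map (arrows G) (arrows G) (inverse_arrow G) \<and>
     (\<forall>(a, b)\<in>points (nerve2 G). src G (mul G a b) = src G b \<and> tgt G (mul G a b) = tgt G a) \<and>
     (\<forall>(a, b, c)\<in>points (nerve3 G). mul G (mul G a b) c = mul G a (mul G b c)) \<and>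
     (\<forall>x\<in>points (objects G). src G (unit_at G x) = x \<and> tgt G (unit_at G x) = x) \<and>
     (\<forall>a\<in>points (arrows G).
        mul G a (unit_at G (src G a)) = a \<and> mul G (unit_at G (tgt G a)) a = a \<and>
        src G (inverse_arrow G a) = tgt G a \<and> tgt G (inverse_arrow G a) = src G a \<and>
        mul G a (inverse_arrow G a) = unit_at G (tgt G a) \<and>
        mul G (inverse_arrow G a) a = unit_at G (src G a))"

definition multiplicative_two_form ::
  "('g, 'ge::euclidean_space, 'm, 'me) groupoid \<Rightarrow> 'g two_form \<Rightarrow> bool" where
  "multiplicative_two_form G \<omega> \<longleftrightarrow>
     (\<forall>p\<in>points (nerve2 G). \<forall>u\<in>tangent_space (nerve2 G) p. \<forall>v\<in>tangent_space (nerve2 G) p.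
        pullback (arrows G) (\<lambda>(a, b). mul G a b) \<omega> p u v =
        pullback (arrows G) fst \<omega> p u v + pullback (arrows G) snd \<omega> p u v)"


section \<open>Double Lie groupoids\<close>

text \<open>The sides \<open>V \<rightrightarrows> M\<close>, \<open>H \<rightrightarrows> M\<close> and the total groupoids \<open>D \<rightrightarrows> H\<close>, \<open>D \<rightrightarrows> V\<close>. Thus \<open>src (DH \<D>)\<close> is
  \<open>s\<^sub>H\<close>, \<open>mul (DH \<D>)\<close> is \<open>\<cdot>\<^sub>H\<close>, and similarly for \<open>V\<close>.\<close>

record ('d, 'de, 'v, 've, 'h, 'he, 'm, 'me) double_groupoid =
  VM :: "('v, 've, 'm, 'me) groupoid"
  HM :: "('h, 'he, 'm, 'me) groupoid"
  DH :: "('d, 'de, 'h, 'he) groupoid"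
  DV :: "('d, 'de, 'v, 've) groupoid"

definition double_lie_groupoid ::
  "('d, 'de::euclidean_space, 'v, 've::euclidean_space, 'h, 'he::euclidean_space,
    'm, 'me::euclidean_space) double_groupoid \<Rightarrow> bool" where
  "double_lie_groupoid \<D> \<longleftrightarrow>
     lie_groupoid (VM \<D>) \<and> lie_groupoid (HM \<D>) \<and> lie_groupoid (DH \<D>) \<and> lie_groupoid (DV \<D>) \<and>
     objects (VM \<D>) = objects (HM \<D>) \<and> arrows (DH \<D>) = arrows (DV \<D>) \<and>
     objects (DH \<D>) = arrows (HM \<D>) \<and> objects (DV \<D>) = arrows (VM \<D>) \<and>
     (\<forall>\<alpha>\<in>points (arrows (DH \<D>)).
        src (HM \<D>) (src (DH \<D>) \<alpha>) = src (VM \<D>) (src (DV \<D>) \<alpha>) \<and>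
        tgt (HM \<D>) (tgt (DH \<D>) \<alpha>) = tgt (VM \<D>) (tgt (DV \<D>) \<alpha>) \<and>
        tgt (HM \<D>) (src (DH \<D>) \<alpha>) = src (VM \<D>) (tgt (DV \<D>) \<alpha>) \<and>
        src (HM \<D>) (tgt (DH \<D>) \<alpha>) = tgt (VM \<D>) (src (DV \<D>) \<alpha>)) \<and>
     (\<forall>(\<alpha>1, \<alpha>2)\<in>points (nerve2 (DH \<D>)).
        src (DV \<D>) (mul (DH \<D>) \<alpha>1 \<alpha>2) = mul (VM \<D>) (src (DV \<D>) \<alpha>1) (src (DV \<D>) \<alpha>2) \<and>
        tgt (DV \<D>) (mul (DH \<D>) \<alpha>1 \<alpha>2) = mul (VM \<D>) (tgt (DV \<D>) \<alpha>1) (tgt (DV \<D>) \<alpha>2)) \<and>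
     (\<forall>(\<alpha>1, \<alpha>3)\<in>points (nerve2 (DV \<D>)).
        src (DH \<D>) (mul (DV \<D>) \<alpha>1 \<alpha>3) = mul (HM \<D>) (src (DH \<D>) \<alpha>1) (src (DH \<D>) \<alpha>3) \<and>
        tgt (DH \<D>) (mul (DV \<D>) \<alpha>1 \<alpha>3) = mul (HM \<D>) (tgt (DH \<D>) \<alpha>1) (tgt (DH \<D>) \<alpha>3)) \<and>
     (\<forall>\<alpha>11 \<alpha>12 \<alpha>21 \<alpha>22.
        (\<alpha>11, \<alpha>12) \<in> points (nerve2 (DH \<D>)) \<and> (\<alpha>21, \<alpha>22) \<in> points (nerve2 (DH \<D>)) \<and>
        (\<alpha>11, \<alpha>21) \<in> points (nerve2 (DV \<D>)) \<and> (\<alpha>12, \<alpha>22) \<in> points (nerve2 (DV \<D>)) \<longrightarrow>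
        mul (DV \<D>) (mul (DH \<D>) \<alpha>11 \<alpha>12) (mul (DH \<D>) \<alpha>21 \<alpha>22) =
        mul (DH \<D>) (mul (DV \<D>) \<alpha>11 \<alpha>21) (mul (DV \<D>) \<alpha>12 \<alpha>22)) \<and>
     submersion (arrows (DH \<D>))
       (sub_space (prod_space (arrows (VM \<D>)) (arrows (HM \<D>))) {(a, b). src (VM \<D>) a = src (HM \<D>) b})
       (\<lambda>\<alpha>. (src (DV \<D>) \<alpha>, src (DH \<D>) \<alpha>))"

definition presymplectic_double_groupoid ::
  "('d, 'de::euclidean_space, 'v, 've::euclidean_space, 'h, 'he::euclidean_space,
    'm, 'me::euclidean_space) double_groupoid \<Rightarrow> 'd two_form \<Rightarrow> bool" where
  "presymplectic_double_groupoid \<D> \<omega> \<longleftrightarrow> double_lie_groupoid \<D> \<and>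
     closed_two_form (arrows (DH \<D>)) \<omega> \<and>
     multiplicative_two_form (DV \<D>) \<omega> \<and> multiplicative_two_form (DH \<D>) \<omega>"


section \<open>Nerve and bar construction in total degrees 2 and 3\<close>

text \<open>For \<open>p + q = 2\<close> or \<open>3\<close> the nerve \<open>N\<^bsub>p,q\<^esub>\<close> of \<open>\<D>\<close> has \<open>N\<^bsub>0,q\<^esub> = V\<^bsup>(q)\<^esup>\<close>, \<open>N\<^bsub>p,0\<^esub> = H\<^bsup>(p)\<^esup>\<close>,
  \<open>N\<^bsub>1,1\<^esub> = D\<close>, \<open>N\<^bsub>1,2\<^esub> = nerve2 (DH \<D>)\<close> and \<open>N\<^bsub>2,1\<^esub> = nerve2 (DV \<D>)\<close>. The digits in the names of
  the horizontal and vertical faces are the \<open>p, q\<close> of the domain. On \<open>N\<^bsub>1,2\<^esub>\<close> the horizontal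
  faces come from the groupoid of \<open>\<cdot>\<^sub>H\<close>-composable pairs over composable pairs in \<open>V\<close>, whose source
  and target are those of \<open>D \<rightrightarrows> V\<close> taken componentwise; dually for the vertical faces on \<open>N\<^bsub>2,1\<^esub>\<close>.\<close>

definition "vface02 \<D> = nerve_face2 (VM \<D>)"
definition "vface03 \<D> = nerve_face3 (VM \<D>)"
definition "hface20 \<D> = nerve_face2 (HM \<D>)"
definition "hface30 \<D> = nerve_face3 (HM \<D>)"
definition "hface11 \<D> = nerve_face1 (DV \<D>)"
definition "vface11 \<D> = nerve_face1 (DH \<D>)"
definition "hface12 \<D> i = map_prod (nerve_face1 (DV \<D>) i) (nerve_face1 (DV \<D>) i)"
definition "vface12 \<D> = nerve_face2 (DH \<D>)"
definition "hface21 \<D> = nerve_face2 (DV \<D>)"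
definition "vface21 \<D> i = map_prod (nerve_face1 (DH \<D>) i) (nerve_face1 (DH \<D>) i)"

definition bar_W2 ::
  "('d, 'de, 'v, 've, 'h, 'he, 'm, 'me) double_groupoid \<Rightarrow>
   (('v \<times> 'v) \<times> 'd \<times> ('h \<times> 'h), ('ve \<times> 've) \<times> 'de \<times> ('he \<times> 'he)) smooth_space" where
  "bar_W2 \<D> = sub_space
     (prod_space (nerve2 (VM \<D>)) (prod_space (arrows (DH \<D>)) (nerve2 (HM \<D>))))
     {(x0, x1, x2). vface02 \<D> 0 x0 = hface11 \<D> 1 x1 \<and> vface11 \<D> 0 x1 = hface20 \<D> 2 x2}"

definition bar_W3 ::
  "('d, 'de, 'v, 've, 'h, 'he, 'm, 'me) double_groupoid \<Rightarrow>
   (('v \<times> 'v \<times> 'v) \<times> ('d \<times> 'd) \<times> ('d \<times> 'd) \<times> ('h \<times> 'h \<times> 'h),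
    ('ve \<times> 've \<times> 've) \<times> ('de \<times> 'de) \<times> ('de \<times> 'de) \<times> ('he \<times> 'he \<times> 'he)) smooth_space" where
  "bar_W3 \<D> = sub_space
     (prod_space (nerve3 (VM \<D>)) (prod_space (nerve2 (DH \<D>)) (prod_space (nerve2 (DV \<D>)) (nerve3 (HM \<D>)))))
     {(x0, x1, x2, x3). vface03 \<D> 0 x0 = hface12 \<D> 1 x1 \<and> vface12 \<D> 0 x1 = hface21 \<D> 2 x2 \<and>
        vface21 \<D> 0 x2 = hface30 \<D> 3 x3}"

definition bar_face3 ::
  "('d, 'de, 'v, 've, 'h, 'he, 'm, 'me) double_groupoid \<Rightarrow> nat \<Rightarrow>
   ('v \<times> 'v \<times> 'v) \<times> ('d \<times> 'd) \<times> ('d \<times> 'd) \<times> ('h \<times> 'h \<times> 'h) \<Rightarrow> ('v \<times> 'v) \<times> 'd \<times> ('h \<times> 'h)" where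
  "bar_face3 \<D> i = (\<lambda>(x0, x1, x2, x3).
     if i = 0 then (hface12 \<D> 0 x1, hface21 \<D> 0 x2, hface30 \<D> 0 x3)
     else if i = 1 then (vface03 \<D> 1 x0, hface21 \<D> 1 x2, hface30 \<D> 1 x3)
     else if i = 2 then (vface03 \<D> 2 x0, vface12 \<D> 1 x1, hface30 \<D> 2 x3)
     else (vface03 \<D> 3 x0, vface12 \<D> 2 x1, vface21 \<D> 1 x2))"

text \<open>A point \<open>((\<theta>, \<theta>'), \<alpha>, (\<eta>', \<eta>))\<close> of \<open>bar_W2 \<D>\<close> has \<open>\<theta>' = t\<^sub>V \<alpha>\<close> and \<open>\<eta>' = s\<^sub>H \<alpha>\<close>, so it is
  determined by \<open>(\<theta>, \<alpha>, \<eta>)\<close> with \<open>s \<theta> = t\<^sup>2 \<alpha>\<close> and \<open>s\<^sup>2 \<alpha> = t \<eta>\<close>; the natural map projects to \<open>\<alpha>\<close>.\<close>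

definition natural_map :: "('v \<times> 'v) \<times> 'd \<times> ('h \<times> 'h) \<Rightarrow> 'd" where
  "natural_map = (\<lambda>(x0, \<alpha>, x2). \<alpha>)"

end

theory Submission
  imports Defs
begin

text \<open>Multiplicativity is a cancellation. A point of \<open>bar_W3 \<D>\<close> contains a \<open>\<cdot>\<^sub>H\<close>-composable pair \<open>(c, d)\<close>
  and a \<open>\<cdot>\<^sub>V\<close>-composable pair \<open>(d, b)\<close> that share the entry \<open>d\<close>. The natural map sends its four faces
  to \<open>b\<close>, \<open>d \<cdot>\<^sub>V b\<close>, \<open>c \<cdot>\<^sub>H d\<close> and \<open>c\<close>. The form pulls back along \<open>d \<cdot>\<^sub>V b\<close> to the sum of its pullbacks
  along \<open>d\<close> and \<open>b\<close>, and along \<open>c \<cdot>\<^sub>H d\<close> to the sum of those along \<open>c\<close> and \<open>d\<close>, so the alternating sum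
  is \<open>b - (d + b) + (c + d) - c = 0\<close>. This uses functoriality of the pushforward of derivations
  (\<open>pushforward_compose\<close>, \<open>multiplicative_pullback\<close>). The two projections to \<open>d\<close> are different functions
  that agree on \<open>bar_W3 \<D>\<close>; they induce the same pushforward because a derivation sees only the values
  of a function on the space (\<open>tangent_vector_cong\<close>).

  Closedness of \<open>\<Omega>\<close> is an instance of \<open>closed_two_form_pullback\<close>: the pullback of a closed 2-form along
  a smooth map is closed. In charts, the coefficients of the pullback are
  \<open>\<Sum>b c. (\<partial>\<^sub>u F\<^sub>b) (\<partial>\<^sub>v F\<^sub>c) \<omega>\<^sub>b\<^sub>c \<circ> F\<close>. In the cyclic sum of their derivatives, the second derivatives
  of \<open>F\<close> cancel, being symmetric where \<open>\<omega>\<close> is alternating, and the remaining terms are the exterior derivative of \<open>\<omega>\<close>. Charts take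
  values in linear subspaces, where functions have derivatives only along the subspace; smooth
  extensions to open sets of the ambient space reduce the rules for these derivatives to those for
  \<open>C\<^sup>k\<close> maps on open sets. The natural map is a composite of projections, so what is left is that
  products and subspaces of smooth spaces are smooth spaces and that smooth maps compose.\<close>


section \<open>Calculus of \<open>C\<^sup>k\<close> maps\<close>

lemma Ck_on_SucD:
  assumes "Ck_on (Suc k) W f"
  shows "x \<in> W \<Longrightarrow> (f has_derivative frechet_derivative f (at x)) (at x)"
    "Ck_on k W (\<lambda>x. frechet_derivative f (at x) v)"
  using assms by (auto simp: frechet_derivative_works[symmetric])

lemma Ck_on_cong:
  assumes "open W" "\<And>x. x \<in> W \<Longrightarrow> f x = g x" "Ck_on k W f"
  shows "Ck_on k W g"
  using assms(2,3)
proof (induction k arbitrary: f g)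
  case 0
  then show ?case using continuous_on_cong[of W W f g] by simp
next
  case (Suc k)
  have d: "(g has_derivative frechet_derivative f (at x)) (at x)" if "x \<in> W" for x
    using Suc.prems that assms(1)
    by (intro has_derivative_transform_within_open[of f _ x UNIV W g])
       (auto simp: frechet_derivative_works[symmetric])
  have eq: "frechet_derivative f (at x) = frechet_derivative g (at x)" if "x \<in> W" for x
    using frechet_derivative_at[OF d[OF that]] .
  have "Ck_on k W (\<lambda>x. frechet_derivative g (at x) v)" for v
    by (rule Suc.IH[of "\<lambda>x. frechet_derivative f (at x) v", OF _ Ck_on_SucD(2)[OF Suc.prems(2)]]) (simp add: eq)
  then show ?case using d by (auto simp: differentiable_def)
qed

text \<open>This admits a derivative in any explicit form, such as one computed by the differentiation
  rules, where the definition speaks of \<open>frechet_derivative\<close>.\<close>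

lemma Ck_on_SucI:
  assumes "open W" "\<And>x. x \<in> W \<Longrightarrow> (f has_derivative f' x) (at x)"
    "\<And>v. Ck_on k W (\<lambda>x. f' x v)"
  shows "Ck_on (Suc k) W f"
proof -
  have "Ck_on k W (\<lambda>x. frechet_derivative f (at x) v)" for v
    by (rule Ck_on_cong[OF assms(1) _ assms(3)[of v]]) (simp add: frechet_derivative_at[OF assms(2), symmetric])
  then show ?thesis using assms(2) by (auto simp: differentiable_def)
qed

lemma Ck_on_Suc_imp:
  assumes "Ck_on (Suc k) W f"
  shows "Ck_on k W f"
  using assms
proof (induction k arbitrary: f)
  case 0
  then show ?case
    by (auto intro!: continuous_at_imp_continuous_on differentiable_imp_continuous_within)
next
  case (Suc k)
  then show ?case by (metis Ck_on.simps(2))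
qed

lemma Ck_on_continuous:
  assumes "Ck_on k W f" shows "continuous_on W f"
  using assms by (induction k) (auto dest: Ck_on_Suc_imp simp del: Ck_on.simps(2))

lemma Ck_on_subset:
  assumes "Ck_on k W f" "W' \<subseteq> W" shows "Ck_on k W' f"
  using assms by (induction k arbitrary: f) (auto intro: continuous_on_subset)

lemma Ck_on_const:
  assumes "open W" shows "Ck_on k W (\<lambda>x. c)"
proof (induction k arbitrary: c)
  case (Suc k)
  then show ?case by (intro Ck_on_SucI[OF assms, where f' = "\<lambda>x v. 0"]) auto
qed (use assms in simp)

lemma Ck_on_linear:
  assumes "open W" "bounded_linear L" "Ck_on k W f"
  shows "Ck_on k W (\<lambda>x. L (f x))"
  using assms(3)
proof (induction k arbitrary: f)
  case 0
  then show ?case using bounded_linear.continuous_on[OF assms(2)] by simp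
next
  case (Suc k)
  show ?case
    by (rule Ck_on_SucI[OF assms(1) bounded_linear.has_derivative[OF assms(2) Ck_on_SucD(1)[OF Suc.prems]]])
       (use Suc.IH[OF Ck_on_SucD(2)[OF Suc.prems]] in auto)
qed

lemma Ck_on_ident:
  assumes "open W" shows "Ck_on k W (\<lambda>x. x)"
proof (cases k)
  case (Suc j)
  show ?thesis unfolding Suc
    by (rule Ck_on_SucI[OF assms, where f' = "\<lambda>x v. v"]) (auto simp: Ck_on_const[OF assms])
qed (use assms in auto)

lemma Ck_on_add:
  assumes "open W" "Ck_on k W f" "Ck_on k W g"
  shows "Ck_on k W (\<lambda>x. f x + g x)"
  using assms(2,3)
proof (induction k arbitrary: f g)
  case 0
  then show ?case by (auto intro: continuous_on_add)
next
  case (Suc k)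
  show ?case
    by (rule Ck_on_SucI[OF assms(1) has_derivative_add[OF Ck_on_SucD(1)[OF Suc.prems(1)]
          Ck_on_SucD(1)[OF Suc.prems(2)]]])
       (use Suc.IH[OF Ck_on_SucD(2)[OF Suc.prems(1)] Ck_on_SucD(2)[OF Suc.prems(2)]] in auto)
qed

lemma Ck_on_sum:
  assumes "open W" "\<And>i. i \<in> I \<Longrightarrow> Ck_on k W (f i)"
  shows "Ck_on k W (\<lambda>x. \<Sum>i\<in>I. f i x)"
  using assms(2)
  by (induction I rule: infinite_finite_induct) (auto intro: Ck_on_const[OF assms(1)] Ck_on_add[OF assms(1)])

text \<open>The derivative of \<open>B f g\<close> contains \<open>f\<close> and \<open>g\<close> themselves, so the induction needs that
  \<open>C\<^sup>k\<^sup>+\<^sup>1\<close> maps are \<open>C\<^sup>k\<close>.\<close>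

lemma Ck_on_bilinear:
  assumes "open W" "bounded_bilinear B" "Ck_on k W f" "Ck_on k W g"
  shows "Ck_on k W (\<lambda>x. B (f x) (g x))"
  using assms(3,4)
proof (induction k arbitrary: f g)
  case 0
  then show ?case using bounded_bilinear.continuous_on[OF assms(2)] by auto
next
  case (Suc k)
  note IH = Suc.IH[OF Ck_on_Suc_imp[OF Suc.prems(1)] Ck_on_SucD(2)[OF Suc.prems(2)]]
    Suc.IH[OF Ck_on_SucD(2)[OF Suc.prems(1)] Ck_on_Suc_imp[OF Suc.prems(2)]]
  show ?case
    by (rule Ck_on_SucI[OF assms(1) bounded_bilinear.FDERIV[OF assms(2) Ck_on_SucD(1)[OF Suc.prems(1)]
          Ck_on_SucD(1)[OF Suc.prems(2)]]])
       (auto intro: Ck_on_add[OF assms(1)] IH)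
qed

text \<open>The derivative of a composite, \<open>Dg(f x)(Df x v)\<close>, is the sum over basis vectors \<open>b\<close> of
  \<open>(Df x v \<bullet> b) Dg(f x) b\<close>; this reduces the \<open>k\<close>-th order statement to products and to composites of
  lower order, so that higher chain rules never appear.\<close>

lemma Ck_on_compose:
  fixes f :: "'a::real_normed_vector \<Rightarrow> 'b::euclidean_space" and g :: "'b \<Rightarrow> 'c::real_normed_vector"
  assumes "open W" "Ck_on k W f" "Ck_on k W' g" "f ` W \<subseteq> W'"
  shows "Ck_on k W (\<lambda>x. g (f x))"
  using assms(2,3)
proof (induction k arbitrary: g)
  case 0
  then show ?case using continuous_on_compose2[OF _ _ assms(4)] by auto
next
  case (Suc k)
  let ?Df = "\<lambda>x. frechet_derivative f (at x)" and ?Dg = "\<lambda>x. frechet_derivative g (at x)"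
  have g: "(g has_derivative ?Dg (f x)) (at (f x))" if "x \<in> W" for x
    using Ck_on_SucD(1)[OF Suc.prems(2)] that assms(4) by blast
  have expand: "?Dg (f x) (?Df x v) = (\<Sum>b\<in>Basis. (?Df x v \<bullet> b) *\<^sub>R ?Dg (f x) b)" if "x \<in> W" for x v
  proof -
    interpret bounded_linear "?Dg (f x)" by (rule has_derivative_bounded_linear[OF g[OF that]])
    show ?thesis by (subst euclidean_representation[symmetric, of "?Df x v"]) (simp add: sum scale)
  qed
  show ?case
  proof (rule Ck_on_SucI[OF assms(1)])
    show "((\<lambda>x. g (f x)) has_derivative (\<lambda>v. ?Dg (f x) (?Df x v))) (at x)" if "x \<in> W" for x
      using has_derivative_compose[OF Ck_on_SucD(1)[OF Suc.prems(1)] g, of x] that by simp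
    show "Ck_on k W (\<lambda>x. ?Dg (f x) (?Df x v))" for v
    proof (rule Ck_on_cong[OF assms(1) expand[symmetric]])
      show "Ck_on k W (\<lambda>x. \<Sum>b\<in>Basis. (?Df x v \<bullet> b) *\<^sub>R ?Dg (f x) b)"
        using Suc.IH[OF Ck_on_Suc_imp[OF Suc.prems(1)] Ck_on_SucD(2)[OF Suc.prems(2)]]
        by (intro Ck_on_sum[OF assms(1)] Ck_on_bilinear[OF assms(1) bounded_bilinear_scaleR]
              Ck_on_linear[OF assms(1) bounded_linear_inner_left] Ck_on_SucD(2)[OF Suc.prems(1)])
    qed
  qed
qed

text \<open>Symmetry of second derivatives. The second difference
  \<open>F (y + hu + hv) - F (y + hu) - F (y + hv) + F y\<close> is symmetric in \<open>u\<close> and \<open>v\<close>, and applying the mean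
  value theorem twice writes it as \<open>h\<^sup>2\<close> times a second derivative at a point tending to \<open>y\<close> with \<open>h\<close>.\<close>

lemma second_difference_mvt:
  fixes F :: "'a::real_normed_vector \<Rightarrow> real"
  assumes C: "Ck_on (Suc (Suc 0)) W F" and h: "0 < h"
    and W: "cball y (h * (norm u + norm v)) \<subseteq> W"
  shows "\<exists>z\<in>cball y (h * (norm u + norm v)).
    F (y + h *\<^sub>R u + h *\<^sub>R v) - F (y + h *\<^sub>R u) - F (y + h *\<^sub>R v) + F y
      = h\<^sup>2 * frechet_derivative (\<lambda>z. frechet_derivative F (at z) u) (at z) v"
proof -
  let ?D = "\<lambda>z. frechet_derivative F (at z) u"
  let ?DD = "\<lambda>z. frechet_derivative ?D (at z) v"
  have in_cball: "y + s *\<^sub>R u + t *\<^sub>R v \<in> cball y (h * (norm u + norm v))"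
    if "0 \<le> s" "s \<le> h" "0 \<le> t" "t \<le> h" for s t
  proof -
    have "norm (s *\<^sub>R u + t *\<^sub>R v) \<le> s * norm u + t * norm v"
      using that norm_triangle_ineq[of "s *\<^sub>R u" "t *\<^sub>R v"] by simp
    also have "\<dots> \<le> h * norm u + h * norm v"
      using that by (intro add_mono mult_right_mono) auto
    finally show ?thesis by (simp add: dist_norm add.assoc norm_minus_commute distrib_left add.commute[of "t *\<^sub>R v"])
  qed
  have W': "y + s *\<^sub>R u + t *\<^sub>R v \<in> W" if "0 \<le> s" "s \<le> h" "0 \<le> t" "t \<le> h" for s t
    using in_cball[OF that] W by blast
  have dF: "((\<lambda>s. F (y + s *\<^sub>R u + t *\<^sub>R v)) has_real_derivative ?D (y + s *\<^sub>R u + t *\<^sub>R v)) (at s)"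
    if "0 \<le> s" "s \<le> h" "0 \<le> t" "t \<le> h" for s t
  proof -
    have 1: "((\<lambda>s. y + s *\<^sub>R u + t *\<^sub>R v) has_derivative (\<lambda>r. r *\<^sub>R u)) (at s)"
      by (auto intro!: derivative_eq_intros)
    note dd = Ck_on_SucD(1)[OF C W'[OF that]]
    show ?thesis
      using has_derivative_compose[OF 1 dd] linear_scale[OF has_derivative_linear[OF dd]]
      by (simp add: has_field_derivative_def mult.commute[of _ "?D _"] mult_commute_abs)
  qed
  have dD: "((\<lambda>t. ?D (y + s *\<^sub>R u + t *\<^sub>R v)) has_real_derivative ?DD (y + s *\<^sub>R u + t *\<^sub>R v)) (at t)"
    if "0 \<le> s" "s \<le> h" "0 \<le> t" "t \<le> h" for s t
  proof -
    have 1: "((\<lambda>t. y + s *\<^sub>R u + t *\<^sub>R v) has_derivative (\<lambda>r. r *\<^sub>R v)) (at t)"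
      by (auto intro!: derivative_eq_intros)
    note dd = Ck_on_SucD(1)[OF Ck_on_SucD(2)[OF C] W'[OF that]]
    show ?thesis
      using has_derivative_compose[OF 1 dd] linear_scale[OF has_derivative_linear[OF dd]]
      by (simp add: has_field_derivative_def mult_commute_abs)
  qed
  obtain s where s: "0 < s" "s < h" and
    1: "F (y + h *\<^sub>R u + h *\<^sub>R v) - F (y + h *\<^sub>R u + 0 *\<^sub>R v) - (F (y + 0 *\<^sub>R u + h *\<^sub>R v) - F (y + 0 *\<^sub>R u + 0 *\<^sub>R v))
      = (h - 0) * (?D (y + s *\<^sub>R u + h *\<^sub>R v) - ?D (y + s *\<^sub>R u + 0 *\<^sub>R v))"
  proof -
    have "\<exists>s. 0 < s \<and> s < h \<and> F (y + h *\<^sub>R u + h *\<^sub>R v) - F (y + h *\<^sub>R u + 0 *\<^sub>R v) - (F (y + 0 *\<^sub>R u + h *\<^sub>R v) - F (y + 0 *\<^sub>R u + 0 *\<^sub>R v))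
      = (h - 0) * (?D (y + s *\<^sub>R u + h *\<^sub>R v) - ?D (y + s *\<^sub>R u + 0 *\<^sub>R v))"
      by (rule MVT2[OF h, of "\<lambda>s. F (y + s *\<^sub>R u + h *\<^sub>R v) - F (y + s *\<^sub>R u + 0 *\<^sub>R v)"])
         (rule DERIV_diff[OF dF dF]; use h in simp)
    then show thesis using that by blast
  qed
  obtain t where t: "0 < t" "t < h" and
    2: "?D (y + s *\<^sub>R u + h *\<^sub>R v) - ?D (y + s *\<^sub>R u + 0 *\<^sub>R v) = (h - 0) * ?DD (y + s *\<^sub>R u + t *\<^sub>R v)"
  proof -
    have "\<exists>t. 0 < t \<and> t < h \<and> ?D (y + s *\<^sub>R u + h *\<^sub>R v) - ?D (y + s *\<^sub>R u + 0 *\<^sub>R v)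
      = (h - 0) * ?DD (y + s *\<^sub>R u + t *\<^sub>R v)"
      by (rule MVT2[OF h, of "\<lambda>t. ?D (y + s *\<^sub>R u + t *\<^sub>R v)"]) (rule dD; use s h in simp)
    then show thesis using that by blast
  qed
  show ?thesis
    using in_cball[of s t] s t 1 2
    by (intro bexI[of _ "y + s *\<^sub>R u + t *\<^sub>R v"]) (auto simp: power2_eq_square)
qed

lemma second_derivative_symmetric:
  fixes F :: "'a::real_normed_vector \<Rightarrow> real"
  assumes "open W" "y \<in> W" "Ck_on (Suc (Suc 0)) W F"
  shows "frechet_derivative (\<lambda>z. frechet_derivative F (at z) u) (at y) v =
    frechet_derivative (\<lambda>z. frechet_derivative F (at z) v) (at y) u"
proof -
  define D2 where "D2 u v z = frechet_derivative (\<lambda>z. frechet_derivative F (at z) u) (at z) v" for u v z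
  (* The summand 1 keeps K positive when u and v vanish. *)
  define K where "K = norm u + norm v + 1"
  have K: "K > 0" by (simp add: K_def add_nonneg_pos)
  obtain r where r: "r > 0" "cball y r \<subseteq> W" using assms(1,2) open_contains_cball by blast
  define h where "h n = r / K / real (Suc n)" for n
  have h: "h n > 0" for n using r K by (simp add: h_def)
  have small: "h n * (norm u + norm v) \<le> r / real (Suc n)" for n
  proof -
    have "h n * (norm u + norm v) \<le> h n * K" using h[of n] by (intro mult_left_mono) (auto simp: K_def)
    also have "\<dots> = r / real (Suc n)" using K by (simp add: h_def)
    finally show ?thesis .
  qed
  have "\<exists>z z'. z \<in> cball y (r / real (Suc n)) \<and> z' \<in> cball y (r / real (Suc n)) \<and> D2 u v z = D2 v u z'" for n
  proof -
    let ?R = "h n * (norm u + norm v)"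
    have "r / real (Suc n) \<le> r" using r divide_left_mono[of 1 "real (Suc n)" r] by simp
    then have "cball y ?R \<subseteq> W" using small[of n] r(2) by force
    then obtain z z' where "z \<in> cball y ?R" "z' \<in> cball y ?R" "D2 u v z = D2 v u z'"
      using second_difference_mvt[OF assms(3) h, of y n u v]
        second_difference_mvt[OF assms(3) h, of y n v u] h[of n]
      unfolding D2_def by (auto simp: add.commute[of "norm v"] algebra_simps)
    then show ?thesis using small[of n] by force
  qed
  then obtain z z' where z: "\<And>n. z n \<in> cball y (r / real (Suc n))" "\<And>n. z' n \<in> cball y (r / real (Suc n))"
    "\<And>n. D2 u v (z n) = D2 v u (z' n)" by metis
  have lim: "w \<longlonglongrightarrow> y" if "\<And>n. w n \<in> cball y (r / real (Suc n))" for w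
  proof (rule metric_LIMSEQ_I)
    fix e :: real assume "e > 0"
    then obtain N where N: "r / e < real N" using reals_Archimedean2 by blast
    have "dist (w n) y < e" if "n \<ge> N" for n
    proof -
      have "dist (w n) y \<le> r / real (Suc n)" using \<open>\<And>n. w n \<in> _\<close>[of n] by (simp add: dist_commute)
      also have "\<dots> < e" using N that \<open>e > 0\<close> by (simp add: field_simps) (smt (verit) mult_less_cancel_left_pos of_nat_mono mult_left_mono)
      finally show ?thesis .
    qed
    then show "\<exists>N. \<forall>n\<ge>N. dist (w n) y < e" by blast
  qed
  have cont: "isCont (D2 u v) y" for u v
  proof -
    have "Ck_on 0 W (D2 u v)" unfolding D2_def by (intro Ck_on_SucD(2) assms(3))
    then show ?thesis using assms(1,2) continuous_on_eq_continuous_at by auto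
  qed
  have "(\<lambda>n. D2 u v (z n)) \<longlonglongrightarrow> D2 u v y" "(\<lambda>n. D2 u v (z n)) \<longlonglongrightarrow> D2 v u y"
    using isCont_tendsto_compose[OF cont lim, OF z(1), of u v]
      isCont_tendsto_compose[OF cont lim, OF z(2), of v u] by (simp_all only: z(3))
  then show ?thesis unfolding D2_def by (rule LIMSEQ_unique)
qed


section \<open>Smooth maps on arbitrary subsets\<close>

lemma smooth_onE:
  assumes "smooth_on A f" "x \<in> A"
  obtains W F where "open W" "x \<in> W" "\<And>k. Ck_on k W F" "\<And>y. y \<in> A \<inter> W \<Longrightarrow> F y = f y"
proof -
  have "\<exists>W F. open W \<and> x \<in> W \<and> (\<forall>k. Ck_on k W F) \<and> (\<forall>y\<in>A \<inter> W. F y = f y)"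
    using assms(1) unfolding smooth_on_def by (rule bspec) (rule assms(2))
  then obtain W F where *: "open W" "x \<in> W" "\<forall>k. Ck_on k W F" "\<forall>y\<in>A \<inter> W. F y = f y"
    by (elim exE conjE)
  show thesis by (rule that[of W F]) (use * in auto)
qed

lemma smooth_onI:
  assumes "\<And>x. x \<in> A \<Longrightarrow> \<exists>W F. open W \<and> x \<in> W \<and> (\<forall>k. Ck_on k W F) \<and> (\<forall>y\<in>A \<inter> W. F y = f y)"
  shows "smooth_on A f"
  using assms unfolding smooth_on_def by (rule ballI)

lemma smooth_on_subset:
  assumes "smooth_on A f" "B \<subseteq> A" shows "smooth_on B f"
proof (rule smooth_onI)
  fix x assume "x \<in> B"
  then obtain W F where W: "open W" "x \<in> W" "\<And>k. Ck_on k W F" "\<And>y. y \<in> A \<inter> W \<Longrightarrow> F y = f y"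
    using smooth_onE[OF assms(1), of x] assms(2) by blast
  then show "\<exists>W F. open W \<and> x \<in> W \<and> (\<forall>k. Ck_on k W F) \<and> (\<forall>y\<in>B \<inter> W. F y = f y)"
    using assms(2) by (intro exI[of _ W] exI[of _ F]) auto
qed

lemma smooth_on_cong:
  assumes "smooth_on A f" "\<And>x. x \<in> A \<Longrightarrow> f x = g x" shows "smooth_on A g"
proof (rule smooth_onI)
  fix x assume x: "x \<in> A"
  obtain W F where W: "open W" "x \<in> W" "\<And>k. Ck_on k W F" "\<And>y. y \<in> A \<inter> W \<Longrightarrow> F y = f y"
    using smooth_onE[OF assms(1) x] by blast
  then show "\<exists>W F. open W \<and> x \<in> W \<and> (\<forall>k. Ck_on k W F) \<and> (\<forall>y\<in>A \<inter> W. F y = g y)"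
    using assms(2) by (intro exI[of _ W] exI[of _ F]) auto
qed

lemma smooth_on_local:
  assumes "\<And>x. x \<in> A \<Longrightarrow> \<exists>N. openin (top_of_set A) N \<and> x \<in> N \<and> smooth_on N f"
  shows "smooth_on A f"
proof (rule smooth_onI)
  fix x assume "x \<in> A"
  then obtain N T where N: "open T" "N = A \<inter> T" "x \<in> N" "smooth_on N f"
    using assms by (metis openin_open)
  then obtain W F where W: "open W" "x \<in> W" "\<And>k. Ck_on k W F" "\<And>y. y \<in> N \<inter> W \<Longrightarrow> F y = f y"
    by (metis smooth_onE)
  show "\<exists>W F. open W \<and> x \<in> W \<and> (\<forall>k. Ck_on k W F) \<and> (\<forall>y\<in>A \<inter> W. F y = f y)"
    using N W Ck_on_subset[OF W(3), of "W \<inter> T"]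
    by (intro exI[of _ "W \<inter> T"] exI[of _ F]) auto
qed

lemma smooth_on_linear:
  assumes "bounded_linear L" shows "smooth_on A L"
  by (rule smooth_onI, rule exI[of _ UNIV], rule exI[of _ L])
     (simp add: Ck_on_linear[OF _ assms Ck_on_ident])

lemma smooth_on_const: "smooth_on A (\<lambda>x. c)"
  by (rule smooth_onI, rule exI[of _ UNIV]) (auto intro!: exI[of _ "\<lambda>x. c"] Ck_on_const)

lemma smooth_on_compose:
  assumes f: "smooth_on A f" and g: "smooth_on B g" and "f ` A \<subseteq> B"
  shows "smooth_on A (\<lambda>x. g (f x))"
proof (rule smooth_onI)
  fix x assume x: "x \<in> A"
  obtain W F where F: "open W" "x \<in> W" "\<And>k. Ck_on k W F" "\<And>y. y \<in> A \<inter> W \<Longrightarrow> F y = f y"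
    using smooth_onE[OF f x] by blast
  obtain W' G where G: "open W'" "f x \<in> W'" "\<And>k. Ck_on k W' G" "\<And>y. y \<in> B \<inter> W' \<Longrightarrow> G y = g y"
    using smooth_onE[OF g] x assms(3) by (metis image_subset_iff)
  let ?W = "W \<inter> F -` W'"
  have "open ?W"
    using continuous_open_preimage[OF Ck_on_continuous[OF F(3)] F(1) G(1)] .
  moreover have "Ck_on k ?W (\<lambda>y. G (F y))" for k
    by (rule Ck_on_compose[OF \<open>open ?W\<close> Ck_on_subset[OF F(3)] G(3)]) auto
  ultimately show "\<exists>W F. open W \<and> x \<in> W \<and> (\<forall>k. Ck_on k W F) \<and> (\<forall>y\<in>A \<inter> W. F y = g (f y))"
    using F G x assms(3) by (intro exI[of _ ?W] exI[of _ "\<lambda>y. G (F y)"]) (auto simp: image_subset_iff)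
qed

lemma smooth_on_binary:
  fixes f :: "'a::euclidean_space \<Rightarrow> 'b::euclidean_space" and g :: "'a \<Rightarrow> 'c::euclidean_space"
  assumes op: "\<And>k (W :: 'a set) F G. open W \<Longrightarrow> Ck_on k W F \<Longrightarrow> Ck_on k W G \<Longrightarrow> Ck_on k W (\<lambda>x. op (F x) (G x))"
    and f: "smooth_on A f" and g: "smooth_on A g"
  shows "smooth_on A (\<lambda>x. op (f x) (g x))"
proof (rule smooth_onI)
  fix x assume x: "x \<in> A"
  obtain W F where F: "open W" "x \<in> W" "\<And>k. Ck_on k W F" "\<And>y. y \<in> A \<inter> W \<Longrightarrow> F y = f y"
    using smooth_onE[OF f x] by blast
  obtain W' G where G: "open W'" "x \<in> W'" "\<And>k. Ck_on k W' G" "\<And>y. y \<in> A \<inter> W' \<Longrightarrow> G y = g y"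
    using smooth_onE[OF g x] by blast
  have "Ck_on k (W \<inter> W') (\<lambda>y. op (F y) (G y))" for k
    using F G by (intro op Ck_on_subset[OF F(3)] Ck_on_subset[OF G(3)]) auto
  then show "\<exists>W F. open W \<and> x \<in> W \<and> (\<forall>k. Ck_on k W F) \<and> (\<forall>y\<in>A \<inter> W. F y = op (f y) (g y))"
    using F G by (intro exI[of _ "W \<inter> W'"] exI[of _ "\<lambda>y. op (F y) (G y)"]) auto
qed

lemma smooth_on_add:
  assumes "smooth_on A f" "smooth_on A g" shows "smooth_on A (\<lambda>x. f x + g x)"
  using smooth_on_binary[OF Ck_on_add assms] .

lemma smooth_on_mult:
  fixes f g :: "'a::euclidean_space \<Rightarrow> real"
  assumes "smooth_on A f" "smooth_on A g" shows "smooth_on A (\<lambda>x. f x * g x)"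
  using smooth_on_binary[OF Ck_on_bilinear[OF _ bounded_bilinear_mult] assms] .

lemma smooth_on_sum:
  assumes "\<And>i. i \<in> I \<Longrightarrow> smooth_on A (f i)" shows "smooth_on A (\<lambda>x. \<Sum>i\<in>I. f i x)"
  using assms by (induction I rule: infinite_finite_induct) (auto intro: smooth_on_const smooth_on_add)

lemma smooth_on_Pair:
  assumes "smooth_on A f" "smooth_on A g" shows "smooth_on A (\<lambda>x. (f x, g x))"
proof -
  have "smooth_on A (\<lambda>x. (f x, 0) + (0, g x))"
    using assms
    by (intro smooth_on_add smooth_on_compose[OF assms(1) smooth_on_linear[of "\<lambda>x. (x, 0)" UNIV]]
          smooth_on_compose[OF assms(2) smooth_on_linear[of "\<lambda>x. (0, x)" UNIV]])
       (auto intro: bounded_linear_Pair)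
  then show ?thesis by simp
qed

lemma smooth_on_inner_left:
  assumes "smooth_on A f" shows "smooth_on A (\<lambda>x. f x \<bullet> b)"
  using smooth_on_compose[OF assms smooth_on_linear[OF bounded_linear_inner_left[of b], of UNIV]] by simp


section \<open>Directional derivatives on relatively open subsets of a linear subspace\<close>

text \<open>A smooth function on a relatively open subset of a subspace \<open>E\<close> has derivatives only in the
  directions of \<open>E\<close>. The calculus of these derivatives rests on local smooth extensions to open
  sets of the ambient space: along \<open>e \<in> E\<close> such an extension has the derivative of the given function.\<close>

lemma smooth_on_extend_open:
  assumes "smooth_on A g" "openin (top_of_set E) A" "y \<in> A"
  obtains W G where "open W" "y \<in> W" "\<And>k. Ck_on k W G" "\<And>z. z \<in> W \<inter> E \<Longrightarrow> z \<in> A \<and> G z = g z"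
proof -
  obtain T where T: "open T" "A = E \<inter> T" using assms(2) by (metis openin_open)
  obtain W G where W: "open W" "y \<in> W" "\<And>k. Ck_on k W G" "\<And>z. z \<in> A \<inter> W \<Longrightarrow> G z = g z"
    using smooth_onE[OF assms(1,3)] by blast
  show thesis
    by (rule that[of "W \<inter> T" G]) (use T W assms(3) Ck_on_subset[OF W(3), of "W \<inter> T"] in auto)
qed

lemma has_dir_deriv_extension:
  assumes "subspace E" "open W" "y \<in> W" "y \<in> E" "e \<in> E" "(G has_derivative G') (at y)"
    "\<And>z. z \<in> W \<inter> E \<Longrightarrow> G z = g z"
  shows "((\<lambda>r. g (y + r *\<^sub>R e)) has_real_derivative G' e) (at 0)"
proof -
  have 1: "((\<lambda>r. y + r *\<^sub>R e) has_derivative (\<lambda>r. r *\<^sub>R e)) (at (0::real))"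
    by (auto intro!: derivative_eq_intros)
  have G: "((\<lambda>r. G (y + r *\<^sub>R e)) has_real_derivative G' e) (at 0)"
    using has_derivative_compose[OF 1, of G G'] assms(6) linear_scale[OF has_derivative_linear[OF assms(6)]]
    by (simp add: has_field_derivative_def mult_commute_abs)
  let ?S = "(\<lambda>r. y + r *\<^sub>R e) -` W"
  have "open ?S" by (intro open_vimage assms(2) continuous_intros)
  show ?thesis
    unfolding has_field_derivative_def
  proof (rule has_derivative_transform_within_open[OF G[unfolded has_field_derivative_def] \<open>open ?S\<close>])
    (* The line y + r e stays in E, where G and g agree. *)
    show "G (y + r *\<^sub>R e) = g (y + r *\<^sub>R e)" if "r \<in> ?S" for r
      using that assms by (auto intro: subspace_add subspace_scale)
  qed (use assms in auto)
qed

lemma dir_deriv_extension: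
  assumes "subspace E" "open W" "y \<in> W" "y \<in> E" "e \<in> E" "(G has_derivative G') (at y)"
    "\<And>z. z \<in> W \<inter> E \<Longrightarrow> G z = g z"
  shows "dir_deriv g y e = G' e"
  unfolding dir_deriv_def by (rule DERIV_imp_deriv[OF has_dir_deriv_extension[OF assms]])

lemma smooth_on_has_dir_deriv:
  assumes "subspace E" "openin (top_of_set E) A" "smooth_on A g" "y \<in> A" "e \<in> E"
  shows "((\<lambda>r. g (y + r *\<^sub>R e)) has_real_derivative dir_deriv g y e) (at 0)"
proof -
  obtain W G where W: "open W" "y \<in> W" "\<And>k. Ck_on k W G" "\<And>z. z \<in> W \<inter> E \<Longrightarrow> z \<in> A \<and> G z = g z"
    using smooth_on_extend_open[OF assms(3,2,4)] by metis
  have yE: "y \<in> E" using assms(2,4) openin_imp_subset by blast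
  have d: "(G has_derivative frechet_derivative G (at y)) (at y)" using Ck_on_SucD(1)[OF W(3) W(2)] .
  show ?thesis
    using has_dir_deriv_extension[OF assms(1) W(1,2) yE assms(5) d]
      dir_deriv_extension[OF assms(1) W(1,2) yE assms(5) d] W(4) by metis
qed

lemma dir_deriv_cong:
  fixes A :: "'a::euclidean_space set"
  assumes "subspace E" "openin (top_of_set E) A" "y \<in> A" "e \<in> E" "\<And>z. z \<in> A \<Longrightarrow> f z = g z"
  shows "dir_deriv f y e = dir_deriv g y e"
proof -
  obtain T where T: "open T" "A = E \<inter> T" using assms(2) by (metis openin_open)
  let ?S = "(\<lambda>r. y + r *\<^sub>R e) -` T"
  have "open ?S" by (intro open_vimage T continuous_intros)
  then have "eventually (\<lambda>r. r \<in> ?S) (nhds 0)"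
    using T assms(3) by (intro eventually_nhds_in_open) auto
  then have "eventually (\<lambda>r. f (y + r *\<^sub>R e) = g (y + r *\<^sub>R e)) (nhds 0)"
    using assms T by (elim eventually_mono) (auto intro: subspace_add subspace_scale)
  then show ?thesis unfolding dir_deriv_def by (intro deriv_cong_ev) auto
qed

lemma dir_deriv_add:
  assumes "subspace E" "openin (top_of_set E) A" "smooth_on A f" "smooth_on A g" "y \<in> A" "e \<in> E"
  shows "dir_deriv (\<lambda>z. f z + g z) y e = dir_deriv f y e + dir_deriv g y e"
  using DERIV_add[OF smooth_on_has_dir_deriv[OF assms(1,2,3,5,6)] smooth_on_has_dir_deriv[OF assms(1,2,4,5,6)]]
  unfolding dir_deriv_def[of "\<lambda>z. f z + g z"] by (rule DERIV_imp_deriv)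

lemma dir_deriv_mult:
  assumes "subspace E" "openin (top_of_set E) A" "smooth_on A f" "smooth_on A g" "y \<in> A" "e \<in> E"
  shows "dir_deriv (\<lambda>z. f z * g z) y e = dir_deriv f y e * g y + f y * dir_deriv g y e"
  using DERIV_mult'[OF smooth_on_has_dir_deriv[OF assms(1,2,3,5,6)] smooth_on_has_dir_deriv[OF assms(1,2,4,5,6)]]
  unfolding dir_deriv_def[of "\<lambda>z. f z * g z"] by (auto dest: DERIV_imp_deriv simp: add.commute)

lemma dir_deriv_sum:
  assumes "subspace E" "openin (top_of_set E) A" "\<And>i. i \<in> I \<Longrightarrow> smooth_on A (f i)" "y \<in> A" "e \<in> E"
  shows "dir_deriv (\<lambda>z. \<Sum>i\<in>I. f i z) y e = (\<Sum>i\<in>I. dir_deriv (f i) y e)"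
proof -
  have "((\<lambda>r. \<Sum>i\<in>I. f i (y + r *\<^sub>R e)) has_real_derivative (\<Sum>i\<in>I. dir_deriv (f i) y e)) (at 0)"
    by (rule DERIV_sum) (rule smooth_on_has_dir_deriv[OF assms(1,2) assms(3) assms(4,5)])
  then show ?thesis unfolding dir_deriv_def[of "\<lambda>z. \<Sum>i\<in>I. f i z"] by (rule DERIV_imp_deriv)
qed

lemma smooth_on_dir_deriv:
  assumes "subspace E" "openin (top_of_set E) A" "smooth_on A g" "e \<in> E"
  shows "smooth_on A (\<lambda>y. dir_deriv g y e)"
proof (rule smooth_onI)
  fix y assume y: "y \<in> A"
  obtain W G where W: "open W" "y \<in> W" "\<And>k. Ck_on k W G" "\<And>z. z \<in> W \<inter> E \<Longrightarrow> z \<in> A \<and> G z = g z"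
    using smooth_on_extend_open[OF assms(3,2) y] by metis
  have "dir_deriv g z e = frechet_derivative G (at z) e" if "z \<in> A \<inter> W" for z
  proof (rule dir_deriv_extension[OF assms(1) W(1) _ _ assms(4) Ck_on_SucD(1)[OF W(3)]])
    show "z \<in> E" using that assms(2) openin_imp_subset by blast
  qed (use that W in auto)
  then show "\<exists>W F. open W \<and> y \<in> W \<and> (\<forall>k. Ck_on k W F) \<and> (\<forall>z\<in>A \<inter> W. F z = dir_deriv g z e)"
    using W Ck_on_SucD(2)[OF W(3)] by (intro exI[of _ W] exI[of _ "\<lambda>z. frechet_derivative G (at z) e"]) simp
qed

lemma dir_deriv_symmetric:
  assumes "subspace E" "openin (top_of_set E) A" "smooth_on A g" "y \<in> A" "u \<in> E" "v \<in> E"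
  shows "dir_deriv (\<lambda>z. dir_deriv g z u) y v = dir_deriv (\<lambda>z. dir_deriv g z v) y u"
proof -
  obtain W G where W: "open W" "y \<in> W" "\<And>k. Ck_on k W G" "\<And>z. z \<in> W \<inter> E \<Longrightarrow> z \<in> A \<and> G z = g z"
    using smooth_on_extend_open[OF assms(3,2,4)] by metis
  have yE: "y \<in> E" using assms(2,4) openin_imp_subset by blast
  have 1: "frechet_derivative G (at z) e = dir_deriv g z e" if "z \<in> W \<inter> E" "e \<in> E" for z e
    using that W by (intro dir_deriv_extension[OF assms(1) W(1) _ _ _ Ck_on_SucD(1)[OF W(3)], symmetric]) auto
  have "dir_deriv (\<lambda>z. dir_deriv g z a) y b = frechet_derivative (\<lambda>z. frechet_derivative G (at z) a) (at y) b"
    if "a \<in> E" "b \<in> E" for a b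
    using that 1 by (intro dir_deriv_extension[OF assms(1) W(1,2) yE _ Ck_on_SucD(1)[OF Ck_on_SucD(2)[OF W(3)] W(2)]]) auto
  then show ?thesis using second_derivative_symmetric[OF W(1,2,3)] assms(5,6) by metis
qed

definition orthonormal_basis_of :: "'a::euclidean_space set \<Rightarrow> 'a set \<Rightarrow> bool" where
  "orthonormal_basis_of B E \<longleftrightarrow> finite B \<and> pairwise orthogonal B \<and> (\<forall>b\<in>B. norm b = 1) \<and> span B = E"

lemma orthonormal_basis_of_exists:
  assumes "subspace E" shows "\<exists>B. orthonormal_basis_of B E"
  using orthonormal_basis_subspace[OF assms] independent_imp_finite
  unfolding orthonormal_basis_of_def by metis

lemma orthonormal_basis_of_subset: "orthonormal_basis_of B E \<Longrightarrow> B \<subseteq> E"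
  unfolding orthonormal_basis_of_def using span_superset by blast

text \<open>The chain rule in the coordinates of an orthonormal basis of \<open>E'\<close>. A map with values in \<open>E'\<close> has its
  derivatives in \<open>E'\<close>, so no direction transverse to \<open>E'\<close>, along which \<open>h\<close> has no derivative, occurs.\<close>

lemma dir_deriv_chain:
  fixes f :: "'a::euclidean_space \<Rightarrow> 'b::euclidean_space"
  assumes E: "subspace E" "openin (top_of_set E) A" and E': "subspace E'" "openin (top_of_set E') A'"
    and f: "smooth_on A f" "f ` A \<subseteq> A'" and h: "smooth_on A' h"
    and B: "orthonormal_basis_of B E'" and y: "y \<in> A" and e: "e \<in> E"
  shows "dir_deriv (\<lambda>z. h (f z)) y e = (\<Sum>b\<in>B. dir_deriv (\<lambda>z. f z \<bullet> b) y e * dir_deriv h (f y) b)"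
proof -
  obtain W F where W: "open W" "y \<in> W" "\<And>k. Ck_on k W F" "\<And>z. z \<in> W \<inter> E \<Longrightarrow> z \<in> A \<and> F z = f z"
    using smooth_on_extend_open[OF f(1) E(2) y] by metis
  have fy: "f y \<in> A'" using f(2) y by blast
  obtain W' H where W': "open W'" "f y \<in> W'" "\<And>k. Ck_on k W' H"
    "\<And>z. z \<in> W' \<inter> E' \<Longrightarrow> z \<in> A' \<and> H z = h z"
    using smooth_on_extend_open[OF h E'(2) fy] by metis
  have AE: "A \<subseteq> E" "A' \<subseteq> E'" using E(2) E'(2) openin_imp_subset by blast+
  have yE: "y \<in> E" "f y \<in> E'" using AE y fy by auto
  have Fy: "F y = f y" using W(2,4) yE by auto
  define F' H' where "F' = frechet_derivative F (at y)" and "H' = frechet_derivative H (at (f y))"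
  have dF: "(F has_derivative F') (at y)" and dH: "(H has_derivative H') (at (f y))"
    unfolding F'_def H'_def using Ck_on_SucD(1)[OF W(3) W(2)] Ck_on_SucD(1)[OF W'(3) W'(2)] by auto
  have coord: "dir_deriv (\<lambda>z. f z \<bullet> b) y e = F' e \<bullet> b" for b
    by (rule dir_deriv_extension[OF E(1) W(1,2) yE(1) e, of "\<lambda>z. F z \<bullet> b"])
       (use W(4) bounded_linear.has_derivative[OF bounded_linear_inner_left dF] in auto)
  (* On E both F and its expansion in the basis B extend f, so they have the same derivative along e. *)
  have expand: "F' e = (\<Sum>b\<in>B. (F' e \<bullet> b) *\<^sub>R b)"
  proof (rule euclidean_eqI)
    fix i :: 'b assume "i \<in> Basis"
    have "dir_deriv (\<lambda>z. f z \<bullet> i) y e = (\<Sum>b\<in>B. (F' e \<bullet> b) *\<^sub>R b) \<bullet> i"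
    proof (rule dir_deriv_extension[OF E(1) W(1,2) yE(1) e, of "\<lambda>z. (\<Sum>b\<in>B. (F z \<bullet> b) *\<^sub>R b) \<bullet> i"])
      show "((\<lambda>z. (\<Sum>b\<in>B. (F z \<bullet> b) *\<^sub>R b) \<bullet> i) has_derivative (\<lambda>v. (\<Sum>b\<in>B. (F' v \<bullet> b) *\<^sub>R b) \<bullet> i)) (at y)"
        by (auto intro!: derivative_eq_intros dF)
      fix z assume "z \<in> W \<inter> E"
      then have "F z = f z" "f z \<in> span B"
        using W(4) f(2) AE B unfolding orthonormal_basis_of_def by auto
      then show "(\<Sum>b\<in>B. (F z \<bullet> b) *\<^sub>R b) \<bullet> i = f z \<bullet> i"
        using B orthonormal_basis_expand[of B "f z"] unfolding orthonormal_basis_of_def by auto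
    qed
    then show "F' e \<bullet> i = (\<Sum>b\<in>B. (F' e \<bullet> b) *\<^sub>R b) \<bullet> i" using coord by simp
  qed
  have dh: "dir_deriv h (f y) b = H' b" if "b \<in> B" for b
    by (rule dir_deriv_extension[OF E'(1) W'(1,2) yE(2) _ dH])
       (use that W'(4) orthonormal_basis_of_subset[OF B] in auto)
  let ?W = "W \<inter> F -` W'"
  have "dir_deriv (\<lambda>z. h (f z)) y e = H' (F' e)"
  proof (rule dir_deriv_extension[OF E(1) _ _ yE(1) e, of ?W "\<lambda>z. H (F z)"])
    show "open ?W" using continuous_open_preimage[OF Ck_on_continuous[OF W(3)] W(1) W'(1)] .
    show "((\<lambda>z. H (F z)) has_derivative (\<lambda>v. H' (F' v))) (at y)"
      using has_derivative_compose[OF dF] dH Fy by metis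
    show "H (F z) = h (f z)" if "z \<in> ?W \<inter> E" for z
    proof -
      have "F z = f z" "f z \<in> W' \<inter> E'" using that W(4)[of z] f(2) AE by auto
      then show ?thesis using W'(4) by simp
    qed
  qed (use W(2) W'(2) Fy in auto)
  also have "\<dots> = (\<Sum>b\<in>B. (F' e \<bullet> b) * H' b)"
    by (subst expand) (simp add: linear_sum[OF has_derivative_linear[OF dH]] linear_scale[OF has_derivative_linear[OF dH]])
  finally show ?thesis using coord dh by simp
qed


section \<open>Pulling back the coefficients of a closed 2-form\<close>

text \<open>The algebra behind \<open>d(f\<^sup>*\<omega>) = f\<^sup>*(d\<omega>)\<close> for 2-forms: \<open>P\<close> stands for the coefficients of \<open>\<omega>\<close>,
  \<open>Q d\<close> for their derivatives along \<open>d\<close>, \<open>x i\<close> for the components of \<open>Df e\<^sub>i\<close> and \<open>S i j\<close> for those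
  of \<open>D\<^sup>2f(e\<^sub>i, e\<^sub>j)\<close>. The terms with \<open>S\<close> cancel because \<open>S\<close> is symmetric and \<open>P\<close> is alternating; the
  remaining ones add up to \<open>d\<omega>(x 1, x 2, x 3)\<close>.\<close>

lemma exterior_derivative_pullback_algebra:
  fixes P :: "'b \<Rightarrow> 'b \<Rightarrow> real" and Q :: "'b \<Rightarrow> 'b \<Rightarrow> 'b \<Rightarrow> real" and x :: "nat \<Rightarrow> 'b \<Rightarrow> real"
  assumes alt: "\<And>b c. b \<in> B \<Longrightarrow> c \<in> B \<Longrightarrow> P b c = - P c b"
    and closed: "\<And>b c d. b \<in> B \<Longrightarrow> c \<in> B \<Longrightarrow> d \<in> B \<Longrightarrow> Q b c d - Q c b d + Q d b c = 0"
    and sym: "\<And>i j b. b \<in> B \<Longrightarrow> S i j b = S j i b"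
  defines "T i j k \<equiv> \<Sum>b\<in>B. \<Sum>c\<in>B. S i k b * x j c * P b c + x i b * S j k c * P b c
      + x i b * x j c * (\<Sum>d\<in>B. x k d * Q d b c)"
  shows "T 2 3 1 - T 1 3 2 + T 1 2 3 = 0"
proof -
  define A where "A u v = (\<Sum>b\<in>B. \<Sum>c\<in>B. u b * v c * P b c)" for u v
  define N where "N i j k = (\<Sum>b\<in>B. \<Sum>c\<in>B. \<Sum>d\<in>B. x i b * x j c * x k d * Q d b c)" for i j k
  have T: "T i j k = A (S i k) (x j) + A (x i) (S j k) + N i j k" for i j k
    unfolding T_def A_def N_def by (simp add: sum.distrib sum_distrib_left mult.assoc)
  have A_alt: "A u v = - A v u" for u v
  proof -
    have "A u v = (\<Sum>c\<in>B. \<Sum>b\<in>B. u b * v c * P b c)" unfolding A_def by (rule sum.swap)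
    also have "\<dots> = (\<Sum>c\<in>B. \<Sum>b\<in>B. - (v c * u b * P c b))"
    proof (intro sum.cong refl)
      fix c b assume "c \<in> B" "b \<in> B"
      then show "u b * v c * P b c = - (v c * u b * P c b)" using alt[of b c] by simp
    qed
    finally show ?thesis unfolding A_def by (simp add: sum_negf)
  qed
  have S: "A (S i j) v = A (S j i) v" "A v (S i j) = A v (S j i)" for i j v
    unfolding A_def using sym[of _ i j] by (auto intro!: sum.cong)
  have N1: "N 2 3 1 = (\<Sum>b\<in>B. \<Sum>c\<in>B. \<Sum>d\<in>B. x 1 b * x 2 c * x 3 d * Q b c d)"
  proof -
    have "N 2 3 1 = (\<Sum>c\<in>B. \<Sum>b\<in>B. \<Sum>d\<in>B. x 2 c * x 3 d * x 1 b * Q b c d)"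
      unfolding N_def by (intro sum.cong refl sum.swap)
    also have "\<dots> = (\<Sum>b\<in>B. \<Sum>c\<in>B. \<Sum>d\<in>B. x 2 c * x 3 d * x 1 b * Q b c d)" by (rule sum.swap)
    finally show ?thesis by (simp add: mult_ac)
  qed
  have N2: "N 1 3 2 = (\<Sum>b\<in>B. \<Sum>c\<in>B. \<Sum>d\<in>B. x 1 b * x 2 c * x 3 d * Q c b d)"
  proof -
    have "N 1 3 2 = (\<Sum>b\<in>B. \<Sum>c\<in>B. \<Sum>d\<in>B. x 1 b * x 3 d * x 2 c * Q c b d)"
      unfolding N_def by (intro sum.cong refl sum.swap)
    then show ?thesis by (simp add: mult_ac)
  qed
  have "N 2 3 1 - N 1 3 2 + N 1 2 3 =
    (\<Sum>b\<in>B. \<Sum>c\<in>B. \<Sum>d\<in>B. x 1 b * x 2 c * x 3 d * (Q b c d - Q c b d + Q d b c))"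
    unfolding N1 N2 unfolding N_def by (simp add: algebra_simps sum.distrib sum_subtractf)
  also have "\<dots> = 0" using closed by simp
  finally have "N 2 3 1 - N 1 3 2 + N 1 2 3 = 0" .
  then show ?thesis
    unfolding T using S(1)[where i = 2 and j = 1 and v = "x 3"] S(1)[where i = 1 and j = 3 and v = "x 2"]
      S(2)[where i = 3 and j = 2 and v = "x 1"] A_alt[of "S 3 1" "x 2"]
    by linarith
qed

text \<open>The coefficient of \<open>f\<^sup>*\<omega>\<close> at the constant vector fields \<open>u\<close>, \<open>v\<close>, where \<open>a b c\<close> are the
  coefficients of \<open>\<omega>\<close> in the orthonormal basis \<open>B\<close>.\<close>

definition pullback_coeff ::
  "'b::euclidean_space set \<Rightarrow> ('b \<Rightarrow> 'b \<Rightarrow> 'b \<Rightarrow> real) \<Rightarrow> ('a::euclidean_space \<Rightarrow> 'b) \<Rightarrow> 'a \<Rightarrow> 'a \<Rightarrow> 'a \<Rightarrow> real" where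
  "pullback_coeff B a f u v y =
    (\<Sum>b\<in>B. \<Sum>c\<in>B. dir_deriv (\<lambda>z. f z \<bullet> b) y u * dir_deriv (\<lambda>z. f z \<bullet> c) y v * a b c (f y))"

text \<open>The product and chain rules bring the derivatives of the coefficients into the form of
  \<open>exterior_derivative_pullback_algebra\<close>, and \<open>dir_deriv_symmetric\<close> gives the symmetry of \<open>S\<close>.\<close>

lemma
  fixes f :: "'a::euclidean_space \<Rightarrow> 'b::euclidean_space"
  assumes E: "subspace E" "openin (top_of_set E) A" and E': "subspace E'" "openin (top_of_set E') A'"
    and f: "smooth_on A f" "f ` A \<subseteq> A'" and B: "orthonormal_basis_of B E'"
    and a: "\<And>b c. b \<in> B \<Longrightarrow> c \<in> B \<Longrightarrow> smooth_on A' (a b c)"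
  shows smooth_on_pullback_coeff:
      "u \<in> E \<Longrightarrow> v \<in> E \<Longrightarrow> smooth_on A (pullback_coeff B a f u v)"
    and pullback_coeff_closed:
      "\<lbrakk>\<And>b c z. \<lbrakk>b \<in> B; c \<in> B; z \<in> A'\<rbrakk> \<Longrightarrow> a b c z = - a c b z;
        \<And>b c d z. \<lbrakk>b \<in> B; c \<in> B; d \<in> B; z \<in> A'\<rbrakk> \<Longrightarrow>
          dir_deriv (a c d) z b - dir_deriv (a b d) z c + dir_deriv (a b c) z d = 0;
        e1 \<in> E; e2 \<in> E; e3 \<in> E; y \<in> A\<rbrakk> \<Longrightarrow>
       dir_deriv (pullback_coeff B a f e2 e3) y e1 - dir_deriv (pullback_coeff B a f e1 e3) y e2
         + dir_deriv (pullback_coeff B a f e1 e2) y e3 = 0"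
proof -
  define D where "D b e y = dir_deriv (\<lambda>z. f z \<bullet> b) y e" for b e y
  have D: "smooth_on A (D b e)" if "e \<in> E" for b e
    unfolding D_def by (rule smooth_on_dir_deriv[OF E smooth_on_inner_left[OF f(1)] that])
  have af: "smooth_on A (\<lambda>y. a b c (f y))" if "b \<in> B" "c \<in> B" for b c
    by (rule smooth_on_compose[OF f(1) a[OF that] f(2)])
  note DD = smooth_on_mult[OF D D]
  have coeff_term: "smooth_on A (\<lambda>y. D b u y * D c v y * a b c (f y))"
    if "u \<in> E" "v \<in> E" "b \<in> B" "c \<in> B" for u v b c
    using that by (intro smooth_on_mult D af)
  have coeff: "pullback_coeff B a f u v = (\<lambda>y. \<Sum>b\<in>B. \<Sum>c\<in>B. D b u y * D c v y * a b c (f y))" for u v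
    unfolding pullback_coeff_def D_def by (rule ext) simp
  show "smooth_on A (pullback_coeff B a f u v)" if "u \<in> E" "v \<in> E" for u v
    unfolding coeff by (intro smooth_on_sum coeff_term that)
  assume alt: "\<And>b c z. \<lbrakk>b \<in> B; c \<in> B; z \<in> A'\<rbrakk> \<Longrightarrow> a b c z = - a c b z"
    and closed: "\<And>b c d z. \<lbrakk>b \<in> B; c \<in> B; d \<in> B; z \<in> A'\<rbrakk> \<Longrightarrow>
          dir_deriv (a c d) z b - dir_deriv (a b d) z c + dir_deriv (a b c) z d = 0"
    and e: "e1 \<in> E" "e2 \<in> E" "e3 \<in> E" and y: "y \<in> A"
  have deriv: "dir_deriv (pullback_coeff B a f u v) y w =
      (\<Sum>b\<in>B. \<Sum>c\<in>B. dir_deriv (D b u) y w * D c v y * a b c (f y)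
        + D b u y * dir_deriv (D c v) y w * a b c (f y)
        + D b u y * D c v y * (\<Sum>d\<in>B. D d w y * dir_deriv (a b c) (f y) d))"
    if uvw: "u \<in> E" "v \<in> E" "w \<in> E" for u v w
  proof -
    have "dir_deriv (\<lambda>y. D b u y * D c v y * a b c (f y)) y w =
        dir_deriv (D b u) y w * D c v y * a b c (f y)
        + D b u y * dir_deriv (D c v) y w * a b c (f y)
        + D b u y * D c v y * (\<Sum>d\<in>B. D d w y * dir_deriv (a b c) (f y) d)"
      if "b \<in> B" "c \<in> B" for b c
      using dir_deriv_mult[OF E DD[OF uvw(1,2)] af[OF that] y uvw(3)]
        dir_deriv_mult[OF E D[OF uvw(1)] D[OF uvw(2)] y uvw(3)]
        dir_deriv_chain[OF E E' f a[OF that] B y uvw(3)]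
      unfolding D_def by (simp add: distrib_right)
    then show ?thesis
      unfolding coeff using uvw y
      by (simp add: dir_deriv_sum[OF E] smooth_on_sum coeff_term)
  qed
  (* The algebraic lemma takes its three vectors as a family indexed by 1, 2, 3. *)
  define ee where "ee i = (if i = (1::nat) then e1 else if i = 2 then e2 else e3)" for i
  have ee: "ee i \<in> E" for i using e by (simp add: ee_def)
  have fy: "f y \<in> A'" using f(2) y by blast
  have sym: "dir_deriv (D b (ee i)) y (ee j) = dir_deriv (D b (ee j)) y (ee i)" for b i j
    unfolding D_def by (rule dir_deriv_symmetric[OF E smooth_on_inner_left[OF f(1)] y ee ee])
  show "dir_deriv (pullback_coeff B a f e2 e3) y e1 - dir_deriv (pullback_coeff B a f e1 e3) y e2
         + dir_deriv (pullback_coeff B a f e1 e2) y e3 = 0"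
    using exterior_derivative_pullback_algebra[of B "\<lambda>b c. a b c (f y)" "\<lambda>d b c. dir_deriv (a b c) (f y) d"
        "\<lambda>i j b. dir_deriv (D b (ee i)) y (ee j)" "\<lambda>i b. D b (ee i) y", OF alt[OF _ _ fy] closed[OF _ _ _ fy] sym]
    unfolding deriv[OF e(2,3,1)] deriv[OF e(1,3,2)] deriv[OF e(1,2,3)]
    by (simp add: ee_def)
qed


section \<open>Smooth spaces and smooth maps\<close>

lemma smooth_space_chartD:
  assumes "smooth_space X" "(U, \<phi>) \<in> charts X"
  shows "openin (topol X) U" "U \<subseteq> points X" "inj_on \<phi> U"
    "homeomorphic_map (subtopology (topol X) U) (top_of_set (\<phi> ` U)) \<phi>"
proof -
  show U: "openin (topol X) U" and
    h: "homeomorphic_map (subtopology (topol X) U) (top_of_set (\<phi> ` U)) \<phi>"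
    using assms unfolding smooth_space_def by blast+
  show U': "U \<subseteq> points X" using U by (rule openin_subset)
  show "inj_on \<phi> U" using homeomorphic_imp_injective_map[OF h] U' by (simp add: Int_absorb1)
qed

lemma smooth_space_chart_at:
  assumes "smooth_space X" "x \<in> points X"
  obtains U \<phi> where "(U, \<phi>) \<in> charts X" "x \<in> U"
  using assms unfolding smooth_space_def by blast

lemma smooth_space_transition:
  assumes "smooth_space X" "(U, \<phi>) \<in> charts X" "(V, \<psi>) \<in> charts X"
  shows "smooth_on (\<phi> ` (U \<inter> V)) (\<psi> \<circ> inv_into U \<phi>)"
proof -
  have *: "\<forall>(U, \<phi>)\<in>charts X. \<forall>(V, \<psi>)\<in>charts X. smooth_on (\<phi> ` (U \<inter> V)) (\<psi> \<circ> inv_into U \<phi>)"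
    using assms(1) unfolding smooth_space_def by (elim conjE)
  show ?thesis using bspec[OF bspec[OF * assms(2), simplified] assms(3)] by simp
qed

lemma openin_chart_image:
  assumes "smooth_space X" "(U, \<phi>) \<in> charts X" "openin (topol X) S"
  shows "openin (top_of_set (\<phi> ` U)) (\<phi> ` (U \<inter> S))"
proof -
  have "openin (subtopology (topol X) U) (U \<inter> S)"
    using assms(3) by (metis inf_commute openin_subtopology_Int)
  then show ?thesis
    using homeomorphic_imp_open_map[OF smooth_space_chartD(4)[OF assms(1,2)]] unfolding open_map_def by blast
qed

lemma smooth_mapD:
  assumes "smooth_map X Y f"
  shows "continuous_map (topol X) (topol Y) f"
    "\<And>x. x \<in> points X \<Longrightarrow> f x \<in> points Y"
    "\<And>U \<phi> V \<psi>. (U, \<phi>) \<in> charts X \<Longrightarrow> (V, \<psi>) \<in> charts Y \<Longrightarrow>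
      smooth_on (\<phi> ` (U \<inter> f -` V)) (\<lambda>y. \<psi> (f (inv_into U \<phi> y)))"
proof -
  show c: "continuous_map (topol X) (topol Y) f" using assms unfolding smooth_map_def by blast
  show "f x \<in> points Y" if "x \<in> points X" for x
    using c that by (simp add: continuous_map_def Pi_iff)
  show "smooth_on (\<phi> ` (U \<inter> f -` V)) (\<lambda>y. \<psi> (f (inv_into U \<phi> y)))"
    if "(U, \<phi>) \<in> charts X" "(V, \<psi>) \<in> charts Y" for U \<phi> V \<psi>
  proof -
    have *: "\<forall>(U, \<phi>)\<in>charts X. \<forall>(V, \<psi>)\<in>charts Y. smooth_on (\<phi> ` (U \<inter> f -` V)) (\<psi> \<circ> f \<circ> inv_into U \<phi>)"
      using assms unfolding smooth_map_def by (elim conjE)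
    show ?thesis using bspec[OF bspec[OF * that(1), simplified] that(2)] by (simp add: comp_def)
  qed
qed

lemma smooth_mapI:
  assumes "continuous_map (topol X) (topol Y) f"
    "\<And>U \<phi> V \<psi>. (U, \<phi>) \<in> charts X \<Longrightarrow> (V, \<psi>) \<in> charts Y \<Longrightarrow>
      smooth_on (\<phi> ` (U \<inter> f -` V)) (\<lambda>y. \<psi> (f (inv_into U \<phi> y)))"
  shows "smooth_map X Y f"
  unfolding smooth_map_def using assms by (auto simp: comp_def)

lemma smooth_map_compose:
  assumes X: "smooth_space X" and Y: "smooth_space Y" and f: "smooth_map X Y f" and g: "smooth_map Y Z g"
  shows "smooth_map X Z (\<lambda>x. g (f x))"
proof (rule smooth_mapI)
  show "continuous_map (topol X) (topol Z) (\<lambda>x. g (f x))"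
    using continuous_map_compose[OF smooth_mapD(1)[OF f] smooth_mapD(1)[OF g]] by (simp add: comp_def)
  fix U \<phi> W \<kappa>
  assume U: "(U, \<phi>) \<in> charts X" and W: "(W, \<kappa>) \<in> charts Z"
  let ?A = "\<phi> ` (U \<inter> (\<lambda>x. g (f x)) -` W)"
  have inj: "inj_on \<phi> U" using smooth_space_chartD(3)[OF X U] .
  show "smooth_on ?A (\<lambda>y. \<kappa> (g (f (inv_into U \<phi> y))))"
  proof (rule smooth_on_local)
    fix y assume "y \<in> ?A"
    then obtain x where x: "x \<in> U" "g (f x) \<in> W" "y = \<phi> x" by blast
    then have "f x \<in> points Y" using smooth_space_chartD(2)[OF X U] smooth_mapD(2)[OF f] by blast
    then obtain V \<psi> where V: "(V, \<psi>) \<in> charts Y" "f x \<in> V" using smooth_space_chart_at[OF Y] by metis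
    have injV: "inj_on \<psi> V" using smooth_space_chartD(3)[OF Y V(1)] .
    (* A chart of Y covers f only near x, which suffices because smoothness is local. *)
    define O' where "O' = {x \<in> points X. f x \<in> V}"
    have O': "openin (topol X) O'"
      unfolding O'_def
      by (rule openin_continuous_map_preimage[OF smooth_mapD(1)[OF f] smooth_space_chartD(1)[OF Y V(1)]])
    let ?N = "?A \<inter> \<phi> ` (U \<inter> O')"
    have "openin (top_of_set ?A) ?N"
      using openin_subtopology_Int2[OF openin_chart_image[OF X U O'], of ?A]
      by (simp add: subtopology_subtopology Int_absorb1 image_mono)
    moreover have "y \<in> ?N" using x V smooth_space_chartD(2)[OF X U] unfolding O'_def by auto
    moreover have "smooth_on ?N (\<lambda>y. \<kappa> (g (f (inv_into U \<phi> y))))"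
    proof -
      have N: "\<exists>x. x \<in> U \<and> f x \<in> V \<and> g (f x) \<in> W \<and> z = \<phi> x \<and> inv_into U \<phi> z = x" if "z \<in> ?N" for z
        using that inj unfolding O'_def by (auto simp: inj_on_eq_iff)
      have "smooth_on ?N (\<lambda>y. \<psi> (f (inv_into U \<phi> y)))"
        by (rule smooth_on_subset[OF smooth_mapD(3)[OF f U V(1)]]) (use N in blast)
      then have "smooth_on ?N (\<lambda>y. \<kappa> (g (inv_into V \<psi> (\<psi> (f (inv_into U \<phi> y))))))"
        by (rule smooth_on_compose[OF _ smooth_mapD(3)[OF g V(1) W]]) (use N in force)
      then show ?thesis
        by (rule smooth_on_cong) (use N injV in force)
    qed
    ultimately show "\<exists>N. openin (top_of_set ?A) N \<and> y \<in> N \<and> smooth_on N (\<lambda>y. \<kappa> (g (f (inv_into U \<phi> y))))"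
      by blast
  qed
qed

lemma smooth_map_id:
  assumes "smooth_space X" shows "smooth_map X X (\<lambda>x. x)"
  by (rule smooth_mapI) (use smooth_space_transition[OF assms] in \<open>auto simp: comp_def\<close>)

lemma points_sub_space: "points (sub_space X S) = points X \<inter> S"
  by (simp add: sub_space_def)

lemma charts_sub_space: "(W, \<phi>) \<in> charts (sub_space X S) \<longleftrightarrow> (\<exists>U. W = U \<inter> S \<and> (U, \<phi>) \<in> charts X)"
  by (auto simp: sub_space_def)

lemma inv_into_subset_eq:
  assumes "inj_on \<phi> U" "A \<subseteq> U" "y \<in> \<phi> ` A" shows "inv_into A \<phi> y = inv_into U \<phi> y"
proof -
  obtain x where "x \<in> A" "y = \<phi> x" using assms(3) by blast
  then show ?thesis
    using inv_into_f_f[OF assms(1), of x] inv_into_f_f[OF inj_on_subset[OF assms(1,2)], of x] assms(2) by auto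
qed

lemma smooth_space_sub_space:
  assumes "smooth_space X" shows "smooth_space (sub_space X S)"
  unfolding smooth_space_def
proof (intro conjI)
  show "\<forall>(W, \<phi>)\<in>charts (sub_space X S). openin (topol (sub_space X S)) W \<and>
      homeomorphic_map (subtopology (topol (sub_space X S)) W) (top_of_set (\<phi> ` W)) \<phi>"
  proof (clarsimp simp: charts_sub_space)
    fix U \<phi> assume U: "(U, \<phi>) \<in> charts X"
    note c = smooth_space_chartD[OF assms U]
    have eq: "subtopology (topol (sub_space X S)) (U \<inter> S) = subtopology (subtopology (topol X) U) S"
      by (simp add: sub_space_def subtopology_subtopology Int_ac)
    have "homeomorphic_map (subtopology (subtopology (topol X) U) S) (subtopology (top_of_set (\<phi> ` U)) (\<phi> ` (U \<inter> S))) \<phi>"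
      by (rule homeomorphic_map_subtopologies) (use c in auto)
    then have "homeomorphic_map (subtopology (subtopology (topol X) U) S) (top_of_set (\<phi> ` (U \<inter> S))) \<phi>"
      by (simp add: subtopology_subtopology Int_absorb1 image_mono)
    then show "openin (topol (sub_space X S)) (U \<inter> S) \<and>
        homeomorphic_map (subtopology (topol (sub_space X S)) (U \<inter> S)) (top_of_set (\<phi> ` (U \<inter> S))) \<phi>"
      unfolding eq using c(1) by (simp add: sub_space_def openin_subtopology_Int)
  qed
  show "points (sub_space X S) = (\<Union>(W, \<phi>)\<in>charts (sub_space X S). W)"
  proof (intro set_eqI iffI)
    fix x assume "x \<in> points (sub_space X S)"
    then have x: "x \<in> points X" "x \<in> S" by (auto simp: points_sub_space)
    obtain U \<phi> where U: "(U, \<phi>) \<in> charts X" "x \<in> U" using smooth_space_chart_at[OF assms x(1)] .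
    have "(U \<inter> S, \<phi>) \<in> charts (sub_space X S)" using U(1) charts_sub_space by metis
    then show "x \<in> (\<Union>(W, \<phi>)\<in>charts (sub_space X S). W)"
      using U(2) x(2) by (intro UN_I[of "(U \<inter> S, \<phi>)"]) auto
  next
    fix x assume "x \<in> (\<Union>(W, \<phi>)\<in>charts (sub_space X S). W)"
    then obtain U \<phi> where U: "(U, \<phi>) \<in> charts X" "x \<in> U \<inter> S" by (auto simp: charts_sub_space)
    then show "x \<in> points (sub_space X S)"
      using smooth_space_chartD(2)[OF assms U(1)] by (auto simp: points_sub_space)
  qed
  show "\<forall>(W, \<phi>)\<in>charts (sub_space X S). \<forall>(W', \<psi>)\<in>charts (sub_space X S).
      smooth_on (\<phi> ` (W \<inter> W')) (\<psi> \<circ> inv_into W \<phi>)"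
  proof (clarsimp simp: charts_sub_space)
    fix U \<phi> V \<psi> assume U: "(U, \<phi>) \<in> charts X" and V: "(V, \<psi>) \<in> charts X"
    have "smooth_on (\<phi> ` (U \<inter> S \<inter> (V \<inter> S))) (\<psi> \<circ> inv_into U \<phi>)"
      by (rule smooth_on_subset[OF smooth_space_transition[OF assms U V]]) auto
    then show "smooth_on (\<phi> ` (U \<inter> S \<inter> (V \<inter> S))) (\<psi> \<circ> inv_into (U \<inter> S) \<phi>)"
    proof (rule smooth_on_cong)
      fix y assume "y \<in> \<phi> ` (U \<inter> S \<inter> (V \<inter> S))"
      then have "y \<in> \<phi> ` (U \<inter> S)" by blast
      then show "(\<psi> \<circ> inv_into U \<phi>) y = (\<psi> \<circ> inv_into (U \<inter> S) \<phi>) y"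
        using inv_into_subset_eq[OF smooth_space_chartD(3)[OF assms U] Int_lower1] by simp
    qed
  qed
qed

lemma smooth_map_from_sub_space:
  assumes "smooth_space X" "smooth_map X Y f"
  shows "smooth_map (sub_space X S) Y f"
proof (rule smooth_mapI)
  show "continuous_map (topol (sub_space X S)) (topol Y) f"
    using smooth_mapD(1)[OF assms(2)] by (simp add: sub_space_def continuous_map_from_subtopology)
  fix W \<phi> V \<psi> assume W: "(W, \<phi>) \<in> charts (sub_space X S)" and V: "(V, \<psi>) \<in> charts Y"
  obtain U where U: "W = U \<inter> S" "(U, \<phi>) \<in> charts X" using W charts_sub_space by metis
  have "smooth_on (\<phi> ` (W \<inter> f -` V)) (\<lambda>y. \<psi> (f (inv_into U \<phi> y)))"
    by (rule smooth_on_subset[OF smooth_mapD(3)[OF assms(2) U(2) V]]) (use U in auto)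
  then show "smooth_on (\<phi> ` (W \<inter> f -` V)) (\<lambda>y. \<psi> (f (inv_into W \<phi> y)))"
    by (rule smooth_on_cong)
       (use inv_into_subset_eq[OF smooth_space_chartD(3)[OF assms(1) U(2)], of W] U in auto)
qed

lemma smooth_map_into_sub_space:
  assumes "smooth_map X Y f" "f ` points X \<subseteq> S"
  shows "smooth_map X (sub_space Y S) f"
proof (rule smooth_mapI)
  show "continuous_map (topol X) (topol (sub_space Y S)) f"
    using smooth_mapD(1)[OF assms(1)] assms(2) by (auto simp: sub_space_def continuous_map_in_subtopology)
  fix U \<phi> W \<psi> assume U: "(U, \<phi>) \<in> charts X" and W: "(W, \<psi>) \<in> charts (sub_space Y S)"
  obtain V where V: "W = V \<inter> S" "(V, \<psi>) \<in> charts Y" using W charts_sub_space by metis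
  show "smooth_on (\<phi> ` (U \<inter> f -` W)) (\<lambda>y. \<psi> (f (inv_into U \<phi> y)))"
    by (rule smooth_on_subset[OF smooth_mapD(3)[OF assms(1) U V(2)]]) (use V in auto)
qed

lemma smooth_space_prod_space:
  assumes X: "smooth_space X" and Y: "smooth_space Y"
  shows "smooth_space (prod_space X Y)"
  unfolding smooth_space_def
proof (intro conjI)
  show "\<forall>(W, \<kappa>)\<in>charts (prod_space X Y). openin (topol (prod_space X Y)) W \<and>
      homeomorphic_map (subtopology (topol (prod_space X Y)) W) (top_of_set (\<kappa> ` W)) \<kappa>"
  proof (clarsimp simp: prod_space_def)
    fix U \<phi> V \<psi> assume U: "(U, \<phi>) \<in> charts X" and V: "(V, \<psi>) \<in> charts Y"
    note cU = smooth_space_chartD[OF X U] and cV = smooth_space_chartD[OF Y V]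
    obtain \<phi>' \<psi>' where "homeomorphic_maps (subtopology (topol X) U) (top_of_set (\<phi> ` U)) \<phi> \<phi>'"
      "homeomorphic_maps (subtopology (topol Y) V) (top_of_set (\<psi> ` V)) \<psi> \<psi>'"
      using cU(4) cV(4) by (meson homeomorphic_map_maps)
    then have "homeomorphic_maps (prod_topology (subtopology (topol X) U) (subtopology (topol Y) V))
        (prod_topology (top_of_set (\<phi> ` U)) (top_of_set (\<psi> ` V)))
        (\<lambda>(x, y). (\<phi> x, \<psi> y)) (\<lambda>(x, y). (\<phi>' x, \<psi>' y))"
      unfolding homeomorphic_maps_prod by blast
    note homeomorphic_maps_imp_map[OF this]
    then show "openin (prod_topology (topol X) (topol Y)) (U \<times> V) \<and>
      homeomorphic_map (subtopology (prod_topology (topol X) (topol Y)) (U \<times> V))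
        (top_of_set (map_prod \<phi> \<psi> ` (U \<times> V))) (map_prod \<phi> \<psi>)"
      using cU(1) cV(1) by (simp add: subtopology_Times map_prod_def openin_prod_Times_iff
          map_prod_surj_on[unfolded map_prod_def, OF refl refl])
  qed
  show "points (prod_space X Y) = (\<Union>(W, \<kappa>)\<in>charts (prod_space X Y). W)"
  proof (intro set_eqI iffI)
    fix p assume "p \<in> points (prod_space X Y)"
    then obtain x y where p: "p = (x, y)" "x \<in> points X" "y \<in> points Y"
      by (auto simp: prod_space_def)
    obtain U \<phi> where U: "(U, \<phi>) \<in> charts X" "x \<in> U" using smooth_space_chart_at[OF X p(2)] .
    obtain V \<psi> where V: "(V, \<psi>) \<in> charts Y" "y \<in> V" using smooth_space_chart_at[OF Y p(3)] .
    have "(U \<times> V, map_prod \<phi> \<psi>) \<in> charts (prod_space X Y)" using U V by (auto simp: prod_space_def)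
    then show "p \<in> (\<Union>(W, \<kappa>)\<in>charts (prod_space X Y). W)"
      using U(2) V(2) p(1) by (intro UN_I[of "(U \<times> V, map_prod \<phi> \<psi>)"]) auto
  next
    fix p assume "p \<in> (\<Union>(W, \<kappa>)\<in>charts (prod_space X Y). W)"
    then obtain U \<phi> V \<psi> where "(U, \<phi>) \<in> charts X" "(V, \<psi>) \<in> charts Y" "p \<in> U \<times> V"
      by (auto simp: prod_space_def)
    then show "p \<in> points (prod_space X Y)"
      using smooth_space_chartD(2)[OF X] smooth_space_chartD(2)[OF Y] by (fastforce simp: prod_space_def)
  qed
  show "\<forall>(W, \<kappa>)\<in>charts (prod_space X Y). \<forall>(W', \<kappa>')\<in>charts (prod_space X Y).
      smooth_on (\<kappa> ` (W \<inter> W')) (\<kappa>' \<circ> inv_into W \<kappa>)"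
  proof (clarsimp simp: prod_space_def)
    fix U \<phi> V \<psi> U' \<phi>' V' \<psi>'
    assume U: "(U, \<phi>) \<in> charts X" and V: "(V, \<psi>) \<in> charts Y"
      and U': "(U', \<phi>') \<in> charts X" and V': "(V', \<psi>') \<in> charts Y"
    note i = smooth_space_chartD(3)[OF X U] smooth_space_chartD(3)[OF Y V]
    let ?A = "map_prod \<phi> \<psi> ` (U \<times> V \<inter> U' \<times> V')"
    have "smooth_on ?A (\<lambda>y. (\<phi>' (inv_into U \<phi> (fst y)), \<psi>' (inv_into V \<psi> (snd y))))"
      by (intro smooth_on_Pair
            smooth_on_compose[OF smooth_on_linear[OF bounded_linear_fst] smooth_space_transition[OF X U U', unfolded comp_def]]
            smooth_on_compose[OF smooth_on_linear[OF bounded_linear_snd] smooth_space_transition[OF Y V V', unfolded comp_def]])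
         auto
    then show "smooth_on ?A (map_prod \<phi>' \<psi>' \<circ> inv_into (U \<times> V) (map_prod \<phi> \<psi>))"
    proof (rule smooth_on_cong)
      fix y assume "y \<in> ?A"
      then obtain a b where ab: "a \<in> U" "b \<in> V" "y = map_prod \<phi> \<psi> (a, b)" by auto
      show "(\<phi>' (inv_into U \<phi> (fst y)), \<psi>' (inv_into V \<psi> (snd y))) =
          (map_prod \<phi>' \<psi>' \<circ> inv_into (U \<times> V) (map_prod \<phi> \<psi>)) y"
        using inv_into_f_f[OF map_prod_inj_on[OF i], of "(a, b)"] ab i by simp
    qed
  qed
qed

lemma smooth_map_fst:
  assumes X: "smooth_space X" and Y: "smooth_space Y"
  shows "smooth_map (prod_space X Y) X fst"
proof (rule smooth_mapI)
  show "continuous_map (topol (prod_space X Y)) (topol X) fst"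
    by (simp add: prod_space_def continuous_map_fst)
  fix W \<kappa> U' \<phi>' assume "(W, \<kappa>) \<in> charts (prod_space X Y)" and U': "(U', \<phi>') \<in> charts X"
  then obtain U \<phi> V \<psi> where W: "W = U \<times> V" "\<kappa> = map_prod \<phi> \<psi>"
    and U: "(U, \<phi>) \<in> charts X" and V: "(V, \<psi>) \<in> charts Y" by (auto simp: prod_space_def)
  note i = smooth_space_chartD(3)[OF X U] smooth_space_chartD(3)[OF Y V]
  have "smooth_on (\<kappa> ` (W \<inter> fst -` U')) (\<lambda>y. \<phi>' (inv_into U \<phi> (fst y)))"
    by (rule smooth_on_compose[OF smooth_on_linear[OF bounded_linear_fst] smooth_space_transition[OF X U U', unfolded comp_def]])
       (auto simp: W)
  then show "smooth_on (\<kappa> ` (W \<inter> fst -` U')) (\<lambda>y. \<phi>' (fst (inv_into W \<kappa> y)))"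
    by (rule smooth_on_cong) (use inv_into_f_f[OF map_prod_inj_on[OF i]] i in \<open>force simp: W\<close>)
qed

lemma smooth_map_snd:
  assumes X: "smooth_space X" and Y: "smooth_space Y"
  shows "smooth_map (prod_space X Y) Y snd"
proof (rule smooth_mapI)
  show "continuous_map (topol (prod_space X Y)) (topol Y) snd"
    by (simp add: prod_space_def continuous_map_snd)
  fix W \<kappa> V' \<psi>' assume "(W, \<kappa>) \<in> charts (prod_space X Y)" and V': "(V', \<psi>') \<in> charts Y"
  then obtain U \<phi> V \<psi> where W: "W = U \<times> V" "\<kappa> = map_prod \<phi> \<psi>"
    and U: "(U, \<phi>) \<in> charts X" and V: "(V, \<psi>) \<in> charts Y" by (auto simp: prod_space_def)
  note i = smooth_space_chartD(3)[OF X U] smooth_space_chartD(3)[OF Y V]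
  have "smooth_on (\<kappa> ` (W \<inter> snd -` V')) (\<lambda>y. \<psi>' (inv_into V \<psi> (snd y)))"
    by (rule smooth_on_compose[OF smooth_on_linear[OF bounded_linear_snd] smooth_space_transition[OF Y V V', unfolded comp_def]])
       (auto simp: W)
  then show "smooth_on (\<kappa> ` (W \<inter> snd -` V')) (\<lambda>y. \<psi>' (snd (inv_into W \<kappa> y)))"
    by (rule smooth_on_cong) (use inv_into_f_f[OF map_prod_inj_on[OF i]] i in \<open>force simp: W\<close>)
qed

lemma smooth_space_euclidean_subset: "smooth_space (euclidean_subset A)"
  unfolding smooth_space_def euclidean_subset_def
  by (auto simp: subtopology_subtopology intro: smooth_on_cong[OF smooth_on_linear[OF bounded_linear_ident]])

lemma sub_space_euclidean_subset:
  assumes "N \<subseteq> A" shows "sub_space (euclidean_subset A) N = euclidean_subset N"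
  using assms by (simp add: sub_space_def euclidean_subset_def subtopology_subtopology Int_absorb1)

lemma smooth_map_euclidean_subsetD:
  assumes "smooth_map (euclidean_subset A) (euclidean_subset B) f"
  shows "f ` A \<subseteq> B" "smooth_on A f"
proof -
  show fA: "f ` A \<subseteq> B" using smooth_mapD(2)[OF assms] by (auto simp: euclidean_subset_def)
  have "smooth_on (id ` (A \<inter> f -` B)) (\<lambda>y. id (f (inv_into A id y)))"
    using smooth_mapD(3)[OF assms, of A id B id] by (simp add: euclidean_subset_def)
  moreover have "id ` (A \<inter> f -` B) = A" using fA by auto
  ultimately have "smooth_on A (\<lambda>y. id (f (inv_into A id y)))" by simp
  then show "smooth_on A f" by (rule smooth_on_cong) (simp add: inv_into_f_f[of id A, simplified])
qed


section \<open>Smooth functions\<close>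

lemma smooth_functions_iff:
  "g \<in> smooth_functions X \<longleftrightarrow> continuous_map (topol X) euclidean g \<and>
    (\<forall>(U, \<phi>)\<in>charts X. smooth_on (\<phi> ` U) (\<lambda>y. g (inv_into U \<phi> y)))"
  by (simp add: smooth_functions_def smooth_map_def euclidean_subset_def comp_def)

lemma smooth_functions_const: "(\<lambda>x. c) \<in> smooth_functions X"
  by (auto simp: smooth_functions_iff smooth_on_const)

lemma smooth_functions_add:
  assumes "g \<in> smooth_functions X" "h \<in> smooth_functions X"
  shows "(\<lambda>x. g x + h x) \<in> smooth_functions X"
  using assms by (auto simp: smooth_functions_iff intro!: continuous_map_add smooth_on_add)

lemma smooth_functions_mult:
  assumes "g \<in> smooth_functions X" "h \<in> smooth_functions X"
  shows "(\<lambda>x. g x * h x) \<in> smooth_functions X"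
  using assms by (auto simp: smooth_functions_iff intro!: continuous_map_real_mult smooth_on_mult)

lemma smooth_functions_cong:
  assumes X: "smooth_space X" and g: "g \<in> smooth_functions X" and eq: "\<And>x. x \<in> points X \<Longrightarrow> g x = h x"
  shows "h \<in> smooth_functions X"
  unfolding smooth_functions_iff
proof (intro conjI ballI, safe)
  show "continuous_map (topol X) euclidean h"
    using continuous_map_eq g eq unfolding smooth_functions_iff by blast
  fix U \<phi> assume U: "(U, \<phi>) \<in> charts X"
  have "smooth_on (\<phi> ` U) (\<lambda>y. g (inv_into U \<phi> y))" using g U unfolding smooth_functions_iff by blast
  then show "smooth_on (\<phi> ` U) (\<lambda>y. h (inv_into U \<phi> y))"
    by (rule smooth_on_cong) (use eq smooth_space_chartD(2)[OF X U] inv_into_into[of _ \<phi> U] in blast)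
qed

lemma smooth_functions_compose:
  assumes "smooth_space X" "smooth_space Y" "smooth_map X Y f" "g \<in> smooth_functions Y"
  shows "g \<circ> f \<in> smooth_functions X"
  using smooth_map_compose[OF assms(1-3)] assms(4) unfolding smooth_functions_def comp_def by blast


section \<open>Tangent vectors\<close>

lemma tangent_spaceD:
  assumes "u \<in> tangent_space X x"
  shows "\<And>g h. g \<in> smooth_functions X \<Longrightarrow> h \<in> smooth_functions X \<Longrightarrow> u (\<lambda>y. g y + h y) = u g + u h"
    "\<And>c g. g \<in> smooth_functions X \<Longrightarrow> u (\<lambda>y. c * g y) = c * u g"
    "\<And>g h. g \<in> smooth_functions X \<Longrightarrow> h \<in> smooth_functions X \<Longrightarrow>
      u (\<lambda>y. g y * h y) = g x * u h + h x * u g"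
    "\<And>g. g \<notin> smooth_functions X \<Longrightarrow> u g = 0"
  using assms unfolding tangent_space_def by blast+

lemma tangent_spaceI:
  assumes "\<And>g h. g \<in> smooth_functions X \<Longrightarrow> h \<in> smooth_functions X \<Longrightarrow> u (\<lambda>y. g y + h y) = u g + u h"
    "\<And>c g. g \<in> smooth_functions X \<Longrightarrow> u (\<lambda>y. c * g y) = c * u g"
    "\<And>g h. g \<in> smooth_functions X \<Longrightarrow> h \<in> smooth_functions X \<Longrightarrow>
      u (\<lambda>y. g y * h y) = g x * u h + h x * u g"
    "\<And>g. g \<notin> smooth_functions X \<Longrightarrow> u g = 0"
  shows "u \<in> tangent_space X x"
  using assms unfolding tangent_space_def by blast

lemma tangent_space_zero: "(\<lambda>g. 0) \<in> tangent_space X x"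
  by (rule tangent_spaceI) auto

lemma tangent_space_add:
  assumes "u \<in> tangent_space X x" "v \<in> tangent_space X x"
  shows "(\<lambda>g. u g + v g) \<in> tangent_space X x"
  by (rule tangent_spaceI) (simp_all add: tangent_spaceD[OF assms(1)] tangent_spaceD[OF assms(2)] algebra_simps)

lemma tangent_space_scale:
  assumes "u \<in> tangent_space X x"
  shows "(\<lambda>g. c * u g) \<in> tangent_space X x"
  by (rule tangent_spaceI) (simp_all add: tangent_spaceD[OF assms] algebra_simps)

lemma tangent_space_sum:
  assumes "finite I" "\<And>i. i \<in> I \<Longrightarrow> t i \<in> tangent_space X x"
  shows "(\<lambda>g. \<Sum>i\<in>I. c i * t i g) \<in> tangent_space X x"
  using assms
proof induction
  case (insert j F)
  have "(\<lambda>g. c j * t j g + (\<Sum>i\<in>F. c i * t i g)) \<in> tangent_space X x"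
    by (intro tangent_space_add tangent_space_scale insert) (use insert in auto)
  then show ?case using insert.hyps by simp
qed (simp add: tangent_space_zero)

text \<open>A derivation sees only the values on the space. The indicator function \<open>\<kappa>\<close> of the
  complement is smooth and idempotent and vanishes at \<open>x\<close>, so \<open>u \<kappa> = 0\<close>; a smooth \<open>k\<close> that vanishes
  on the space equals \<open>k \<kappa>\<close>, so \<open>u k = k x * u \<kappa> + \<kappa> x * u k = 0\<close>.\<close>

lemma tangent_vector_cong:
  assumes X: "smooth_space X" and u: "u \<in> tangent_space X x" and x: "x \<in> points X"
    and g: "g \<in> smooth_functions X" and eq: "\<And>y. y \<in> points X \<Longrightarrow> g y = h y"
  shows "u g = u h"
proof -
  have h: "h \<in> smooth_functions X" by (rule smooth_functions_cong[OF X g eq])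
  define \<kappa> where "\<kappa> y = (if y \<in> points X then 0 else 1 :: real)" for y
  define k where "k y = h y + (- 1) * g y" for y
  have \<kappa>: "\<kappa> \<in> smooth_functions X"
    by (rule smooth_functions_cong[OF X smooth_functions_const[of 0]]) (simp add: \<kappa>_def)
  have g': "(\<lambda>y. (- 1) * g y) \<in> smooth_functions X" by (rule smooth_functions_mult[OF smooth_functions_const g])
  have k: "k \<in> smooth_functions X"
    unfolding k_def by (rule smooth_functions_add[OF h g'])
  have \<kappa>x: "\<kappa> x = 0" using x by (simp add: \<kappa>_def)
  have "(\<lambda>y. \<kappa> y * \<kappa> y) = \<kappa>" by (auto simp: \<kappa>_def)
  then have u\<kappa>: "u \<kappa> = 0" using tangent_spaceD(3)[OF u \<kappa> \<kappa>] \<kappa>x by simp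
  have "(\<lambda>y. k y * \<kappa> y) = k" using eq by (auto simp: \<kappa>_def k_def)
  then have "u k = 0" using tangent_spaceD(3)[OF u k \<kappa>] \<kappa>x u\<kappa> by simp
  moreover have "u k = u h + (- 1) * u g"
    unfolding k_def using tangent_spaceD(1)[OF u h g'] tangent_spaceD(2)[OF u g, of "- 1"] by simp
  ultimately show ?thesis by simp
qed

lemma pushforward_tangent:
  assumes "smooth_space X" "smooth_space Y" "smooth_map X Y f" "u \<in> tangent_space X x"
  shows "pushforward Y f u \<in> tangent_space Y (f x)"
proof -
  note c = smooth_functions_compose[OF assms(1-3)]
  have c': "\<And>g. g \<in> smooth_functions Y \<Longrightarrow> (\<lambda>x. g (f x)) \<in> smooth_functions X"
    using c by (simp add: comp_def)
  show ?thesis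
    by (rule tangent_spaceI)
       (simp_all add: pushforward_def smooth_functions_add smooth_functions_mult smooth_functions_const
          comp_def tangent_spaceD[OF assms(4)] c')
qed

text \<open>Smoothness of \<open>g\<close> makes \<open>h \<circ> g\<close> smooth for every smooth \<open>h\<close>, so the inner pushforward is
  never evaluated at a function where it takes its default value \<open>0\<close>.\<close>

lemma pushforward_compose:
  assumes "smooth_space Y" "smooth_space Z" "smooth_map Y Z g"
  shows "pushforward Z g (pushforward Y f u) = pushforward Z (\<lambda>x. g (f x)) u"
  using smooth_functions_compose[OF assms] by (auto simp: pushforward_def comp_def)

lemma pushforward_cong:
  assumes "smooth_space X" "smooth_space Y" "smooth_map X Y f" "u \<in> tangent_space X x" "x \<in> points X"
    "\<And>y. y \<in> points X \<Longrightarrow> f y = f' y"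
  shows "pushforward Y f u = pushforward Y f' u"
proof
  fix g
  have "u (g \<circ> f) = u (g \<circ> f')" if "g \<in> smooth_functions Y"
    by (rule tangent_vector_cong[OF assms(1,4,5) smooth_functions_compose[OF assms(1-3) that]])
       (simp add: assms(6))
  then show "pushforward Y f u g = pushforward Y f' u g" by (simp add: pushforward_def)
qed


section \<open>Manifold charts and coordinate vectors\<close>

lemma manifold_chartD:
  assumes "manifold_chart X E U \<phi>"
  shows "subspace E" "openin (topol X) U" "U \<subseteq> points X" "inj_on \<phi> U" "openin (top_of_set E) (\<phi> ` U)"
    "smooth_map (sub_space X U) (euclidean_subset (\<phi> ` U)) \<phi>"
    "smooth_map (euclidean_subset (\<phi> ` U)) (sub_space X U) (inv_into U \<phi>)"
  using assms openin_subset[of "topol X" U] by (simp_all add: manifold_chart_def)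

lemma manifold_chart_inverse_smooth:
  assumes X: "smooth_space X" and c: "manifold_chart X E U \<phi>"
  shows "smooth_map (euclidean_subset (\<phi> ` U)) X (inv_into U \<phi>)"
  by (rule smooth_map_compose[OF smooth_space_euclidean_subset smooth_space_sub_space[OF X]
        manifold_chartD(7)[OF c] smooth_map_from_sub_space[OF X smooth_map_id[OF X]]])

text \<open>A manifold chart need not belong to the atlas. It is compared with the atlas through the
  smoothness of its inverse.\<close>

lemma smooth_function_in_chart:
  assumes X: "smooth_space X" and c: "manifold_chart X E U \<phi>" and g: "g \<in> smooth_functions X"
  shows "smooth_on (\<phi> ` U) (\<lambda>y. g (inv_into U \<phi> y))"
proof -
  have "g \<circ> inv_into U \<phi> \<in> smooth_functions (euclidean_subset (\<phi> ` U))"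
    by (rule smooth_functions_compose[OF smooth_space_euclidean_subset X manifold_chart_inverse_smooth[OF X c] g])
  then show ?thesis
    unfolding smooth_functions_def using smooth_map_euclidean_subsetD(2) by (auto simp: comp_def)
qed

lemma smooth_map_in_charts:
  assumes X: "smooth_space X" and Y: "smooth_space Y" and f: "smooth_map X Y f"
    and c: "manifold_chart X E U \<phi>" and d: "manifold_chart Y E' V \<psi>"
  defines "N \<equiv> \<phi> ` (U \<inter> f -` V)" and "F \<equiv> \<lambda>y. \<psi> (f (inv_into U \<phi> y))"
  shows "openin (top_of_set E) N" "smooth_on N F" "F ` N \<subseteq> \<psi> ` V"
proof -
  note C = manifold_chartD[OF c] and D = manifold_chartD[OF d]
  have N: "N = {y \<in> \<phi> ` U. f (inv_into U \<phi> y) \<in> V}"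
    unfolding N_def using C(4) by auto
  have sm: "smooth_map (euclidean_subset (\<phi> ` U)) Y (\<lambda>y. f (inv_into U \<phi> y))"
    by (rule smooth_map_compose[OF smooth_space_euclidean_subset X manifold_chart_inverse_smooth[OF X c] f])
  have "openin (top_of_set (\<phi> ` U)) N"
    using openin_continuous_map_preimage[OF smooth_mapD(1)[OF sm] D(2)]
    unfolding N by (simp add: euclidean_subset_def)
  then show "openin (top_of_set E) N" using C(5) by (rule openin_trans)
  have NU: "N \<subseteq> \<phi> ` U" using N by blast
  have "smooth_map (euclidean_subset N) Y (\<lambda>y. f (inv_into U \<phi> y))"
    using smooth_map_from_sub_space[OF smooth_space_euclidean_subset sm, of N]
    by (simp add: sub_space_euclidean_subset[OF NU])
  then have "smooth_map (euclidean_subset N) (sub_space Y V) (\<lambda>y. f (inv_into U \<phi> y))"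
    by (rule smooth_map_into_sub_space) (auto simp: euclidean_subset_def N)
  then have "smooth_map (euclidean_subset N) (euclidean_subset (\<psi> ` V)) F"
    unfolding F_def by (rule smooth_map_compose[OF smooth_space_euclidean_subset smooth_space_sub_space[OF Y] _ D(6)])
  then show "F ` N \<subseteq> \<psi> ` V" "smooth_on N F" by (rule smooth_map_euclidean_subsetD)+
qed

lemma coord_vector_tangent:
  assumes X: "smooth_space X" and c: "manifold_chart X E U \<phi>" and x: "x \<in> U" and e: "e \<in> E"
  shows "coord_vector X U \<phi> x e \<in> tangent_space X x"
proof -
  note C = manifold_chartD[OF c]
  have y: "\<phi> x \<in> \<phi> ` U" using x by blast
  note s = smooth_function_in_chart[OF X c]
  have inv: "inv_into U \<phi> (\<phi> x) = x" using C(4) x by (rule inv_into_f_f)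
  have const: "dir_deriv (\<lambda>z. c) y e = 0" for c y by (simp add: dir_deriv_def)
  show ?thesis
  proof (rule tangent_spaceI)
    fix g h assume g: "g \<in> smooth_functions X" and h: "h \<in> smooth_functions X"
    show "coord_vector X U \<phi> x e (\<lambda>y. g y + h y) = coord_vector X U \<phi> x e g + coord_vector X U \<phi> x e h"
      using dir_deriv_add[OF C(1,5) s[OF g] s[OF h] y e]
      by (simp add: coord_vector_def comp_def g h smooth_functions_add)
    show "coord_vector X U \<phi> x e (\<lambda>y. g y * h y) = g x * coord_vector X U \<phi> x e h + h x * coord_vector X U \<phi> x e g"
      using dir_deriv_mult[OF C(1,5) s[OF g] s[OF h] y e]
      by (simp add: coord_vector_def comp_def g h smooth_functions_mult inv)
  next
    fix c g assume g: "g \<in> smooth_functions X"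
    show "coord_vector X U \<phi> x e (\<lambda>y. c * g y) = c * coord_vector X U \<phi> x e g"
      using dir_deriv_mult[OF C(1,5) smooth_on_const s[OF g] y e, of c]
      by (simp add: coord_vector_def comp_def g smooth_functions_mult smooth_functions_const const)
  qed (simp add: coord_vector_def)
qed

text \<open>A test function \<open>g\<close> satisfies \<open>g \<circ> f \<circ> \<phi>\<inverse> = (g \<circ> \<psi>\<inverse>) \<circ> (\<psi> \<circ> f \<circ> \<phi>\<inverse>)\<close> near \<open>\<phi> x\<close>, so this is
  the chain rule for directional derivatives: the Jacobian matrix of \<open>f\<close> in the two charts.\<close>

lemma pushforward_coord_vector:
  assumes X: "smooth_space X" and Y: "smooth_space Y" and f: "smooth_map X Y f"
    and c: "manifold_chart X E U \<phi>" and d: "manifold_chart Y E' V \<psi>" and B: "orthonormal_basis_of B E'"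
    and x: "x \<in> U" "f x \<in> V" and e: "e \<in> E"
  shows "pushforward Y f (coord_vector X U \<phi> x e) =
    (\<lambda>g. \<Sum>b\<in>B. dir_deriv (\<lambda>y. \<psi> (f (inv_into U \<phi> y)) \<bullet> b) (\<phi> x) e * coord_vector Y V \<psi> (f x) b g)"
proof
  fix g
  let ?F = "\<lambda>y. \<psi> (f (inv_into U \<phi> y))" and ?N = "\<phi> ` (U \<inter> f -` V)"
  note C = manifold_chartD[OF c] and D = manifold_chartD[OF d]
  note F = smooth_map_in_charts[OF X Y f c d]
  show "pushforward Y f (coord_vector X U \<phi> x e) g =
    (\<Sum>b\<in>B. dir_deriv (\<lambda>y. ?F y \<bullet> b) (\<phi> x) e * coord_vector Y V \<psi> (f x) b g)"
  proof (cases "g \<in> smooth_functions Y")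
    case True
    have y: "\<phi> x \<in> ?N" using x by blast
    have Fy: "?F (\<phi> x) = \<psi> (f x)" using inv_into_f_f[OF C(4) x(1)] by simp
    have "dir_deriv (\<lambda>y. g (f (inv_into U \<phi> y))) (\<phi> x) e = dir_deriv (\<lambda>y. g (inv_into V \<psi> (?F y))) (\<phi> x) e"
    proof (rule dir_deriv_cong[OF C(1) F(1) y e])
      fix z assume "z \<in> ?N"
      then have "f (inv_into U \<phi> z) \<in> V" using C(4) by auto
      then show "g (f (inv_into U \<phi> z)) = g (inv_into V \<psi> (?F z))" using D(4) by simp
    qed
    also have "\<dots> = (\<Sum>b\<in>B. dir_deriv (\<lambda>y. ?F y \<bullet> b) (\<phi> x) e * dir_deriv (\<lambda>z. g (inv_into V \<psi> z)) (?F (\<phi> x)) b)"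
      by (rule dir_deriv_chain[OF C(1) F(1) D(1,5) F(2,3) smooth_function_in_chart[OF Y d True] B y e])
    finally show ?thesis
      using True smooth_functions_compose[OF X Y f True]
      by (simp add: pushforward_def coord_vector_def comp_def Fy)
  qed (simp add: pushforward_def coord_vector_def)
qed


section \<open>Pullback of closed 2-forms\<close>

lemma two_formD:
  assumes "two_form X \<omega>" "x \<in> points X"
  shows "\<And>u. u \<in> tangent_space X x \<Longrightarrow> \<omega> x u u = 0"
    "\<And>u v w. u \<in> tangent_space X x \<Longrightarrow> v \<in> tangent_space X x \<Longrightarrow> w \<in> tangent_space X x \<Longrightarrow>
      \<omega> x (\<lambda>g. u g + v g) w = \<omega> x u w + \<omega> x v w"
    "\<And>u v w. u \<in> tangent_space X x \<Longrightarrow> v \<in> tangent_space X x \<Longrightarrow> w \<in> tangent_space X x \<Longrightarrow>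
      \<omega> x w (\<lambda>g. u g + v g) = \<omega> x w u + \<omega> x w v"
    "\<And>u w c. u \<in> tangent_space X x \<Longrightarrow> w \<in> tangent_space X x \<Longrightarrow> \<omega> x (\<lambda>g. c * u g) w = c * \<omega> x u w"
    "\<And>u w c. u \<in> tangent_space X x \<Longrightarrow> w \<in> tangent_space X x \<Longrightarrow> \<omega> x w (\<lambda>g. c * u g) = c * \<omega> x w u"
  using assms unfolding two_form_def by (simp_all only: Ball_def)

lemma two_form_skew:
  assumes \<omega>: "two_form X \<omega>" "x \<in> points X" and u: "u \<in> tangent_space X x" and v: "v \<in> tangent_space X x"
  shows "\<omega> x u v = - \<omega> x v u"
proof -
  note uv = tangent_space_add[OF u v]
  have "0 = \<omega> x (\<lambda>g. u g + v g) (\<lambda>g. u g + v g)" using two_formD(1)[OF \<omega> uv] by simp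
  also have "\<dots> = \<omega> x u u + \<omega> x u v + (\<omega> x v u + \<omega> x v v)"
    using two_formD(2)[OF \<omega> u v uv] two_formD(3)[OF \<omega> u v u] two_formD(3)[OF \<omega> u v v] by simp
  finally show ?thesis using two_formD(1)[OF \<omega> u] two_formD(1)[OF \<omega> v] by simp
qed

lemma two_form_sum:
  assumes \<omega>: "two_form X \<omega>" "x \<in> points X" and I: "finite I"
    and t: "\<And>i. i \<in> I \<Longrightarrow> t i \<in> tangent_space X x" and w: "w \<in> tangent_space X x"
  shows "\<omega> x (\<lambda>g. \<Sum>i\<in>I. c i * t i g) w = (\<Sum>i\<in>I. c i * \<omega> x (t i) w)"
    and "\<omega> x w (\<lambda>g. \<Sum>i\<in>I. c i * t i g) = (\<Sum>i\<in>I. c i * \<omega> x w (t i))"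
proof -
  have "\<omega> x (\<lambda>g. \<Sum>i\<in>I. c i * t i g) w = (\<Sum>i\<in>I. c i * \<omega> x (t i) w) \<and>
    \<omega> x w (\<lambda>g. \<Sum>i\<in>I. c i * t i g) = (\<Sum>i\<in>I. c i * \<omega> x w (t i))"
    using I t
  proof induction
    case empty
    then show ?case using two_formD(4)[OF \<omega> w w, of 0] two_formD(5)[OF \<omega> w w, of 0] by simp
  next
    case (insert j F)
    have tj: "t j \<in> tangent_space X x" using insert.prems by blast
    have tF: "(\<lambda>g. \<Sum>i\<in>F. c i * t i g) \<in> tangent_space X x"
      using insert.prems by (intro tangent_space_sum insert.hyps) auto
    note cj = tangent_space_scale[OF tj, of "c j"]
    show ?case
      using insert.IH insert.prems insert.hyps two_formD(2)[OF \<omega> cj tF w] two_formD(3)[OF \<omega> cj tF w]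
        two_formD(4)[OF \<omega> tj w, of "c j"] two_formD(5)[OF \<omega> tj w, of "c j"]
      by simp
  qed
  then show "\<omega> x (\<lambda>g. \<Sum>i\<in>I. c i * t i g) w = (\<Sum>i\<in>I. c i * \<omega> x (t i) w)"
    "\<omega> x w (\<lambda>g. \<Sum>i\<in>I. c i * t i g) = (\<Sum>i\<in>I. c i * \<omega> x w (t i))" by auto
qed

text \<open>Bilinear expansion of \<open>\<omega>\<close> along \<open>pushforward_coord_vector\<close>.\<close>

lemma coord_coeff_pullback:
  assumes X: "smooth_space X" and Y: "smooth_space Y" and f: "smooth_map X Y f" and \<omega>: "two_form Y \<omega>"
    and c: "manifold_chart X E U \<phi>" and d: "manifold_chart Y E' V \<psi>" and B: "orthonormal_basis_of B E'"
    and y: "y \<in> \<phi> ` (U \<inter> f -` V)" and e: "e1 \<in> E" "e2 \<in> E"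
  shows "coord_coeff X U \<phi> (pullback Y f \<omega>) e1 e2 y =
    pullback_coeff B (coord_coeff Y V \<psi> \<omega>) (\<lambda>z. \<psi> (f (inv_into U \<phi> z))) e1 e2 y"
proof -
  obtain x where x: "x \<in> U" "f x \<in> V" "y = \<phi> x" using y by blast
  note C = manifold_chartD[OF c] and D = manifold_chartD[OF d]
  have inv: "inv_into U \<phi> y = x" "inv_into V \<psi> (\<psi> (f x)) = f x"
    using inv_into_f_f[OF C(4) x(1)] inv_into_f_f[OF D(4) x(2)] x(3) by auto
  have fx: "f x \<in> points Y" using D(3) x(2) by blast
  have fin: "finite B" and BE: "B \<subseteq> E'"
    using B orthonormal_basis_of_subset[OF B] by (auto simp: orthonormal_basis_of_def)
  let ?t = "\<lambda>b. coord_vector Y V \<psi> (f x) b"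
  let ?D = "\<lambda>b e. dir_deriv (\<lambda>z. \<psi> (f (inv_into U \<phi> z)) \<bullet> b) y e"
  have t: "?t b \<in> tangent_space Y (f x)" if "b \<in> B" for b
    using coord_vector_tangent[OF Y d x(2)] BE that by blast
  have push: "pushforward Y f (coord_vector X U \<phi> x e) = (\<lambda>g. \<Sum>b\<in>B. ?D b e * ?t b g)" if "e \<in> E" for e
    using pushforward_coord_vector[OF X Y f c d B x(1,2) that] by (simp add: x(3))
  have "coord_coeff X U \<phi> (pullback Y f \<omega>) e1 e2 y
      = \<omega> (f x) (\<lambda>g. \<Sum>b\<in>B. ?D b e1 * ?t b g) (\<lambda>g. \<Sum>b\<in>B. ?D b e2 * ?t b g)"
    by (simp add: coord_coeff_def pullback_def inv push e)
  also have "\<dots> = (\<Sum>b\<in>B. ?D b e1 * (\<Sum>b'\<in>B. ?D b' e2 * \<omega> (f x) (?t b) (?t b')))"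
    using two_form_sum[OF \<omega> fx fin t] tangent_space_sum[OF fin t] t by simp
  finally show ?thesis
    by (simp add: pullback_coeff_def coord_coeff_def Let_def inv sum_distrib_left mult.assoc)
qed

text \<open>Smoothness and closedness can be tested near each point. There, in a chart of the source and
  a chart of the target around the image point, the coefficients of \<open>f\<^sup>*\<omega>\<close> are those treated by
  \<open>smooth_on_pullback_coeff\<close> and \<open>pullback_coeff_closed\<close>.\<close>

theorem closed_two_form_pullback:
  assumes X: "smooth_space X" and Y: "manifold Y" and f: "smooth_map X Y f" and \<omega>: "closed_two_form Y \<omega>"
  shows "closed_two_form X (pullback Y f \<omega>)"
proof -
  have Ys: "smooth_space Y" using Y by (simp add: manifold_def)
  have two: "two_form Y \<omega>" using \<omega> by (simp add: closed_two_form_def)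
  note push = pushforward_tangent[OF X Ys f]
  have charts_at: "\<exists>E' V \<psi> B. manifold_chart Y E' V \<psi> \<and> orthonormal_basis_of B E' \<and> y \<in> \<phi> ` (U \<inter> f -` V)"
    if c: "manifold_chart X E U \<phi>" and y: "y \<in> \<phi> ` U" for E U \<phi> y
  proof -
    obtain x where x: "x \<in> U" "y = \<phi> x" using y by blast
    then have "f x \<in> points Y" using manifold_chartD(3)[OF c] smooth_mapD(2)[OF f] by blast
    then obtain E' V \<psi> where d: "manifold_chart Y E' V \<psi>" "f x \<in> V" using Y unfolding manifold_def by metis
    obtain B where "orthonormal_basis_of B E'"
      using orthonormal_basis_of_exists[OF manifold_chartD(1)[OF d(1)]] by blast
    moreover have "y \<in> \<phi> ` (U \<inter> f -` V)" using d(2) x by blast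
    ultimately show ?thesis using d(1) by (intro exI conjI)
  qed
  have coeff: "smooth_on (\<psi> ` V) (coord_coeff Y V \<psi> \<omega> b c)"
    if "manifold_chart Y E' V \<psi>" "orthonormal_basis_of B E'" "b \<in> B" "c \<in> B" for E' V \<psi> B b c
  proof -
    have all: "\<forall>E U \<phi>. manifold_chart Y E U \<phi> \<longrightarrow>
        (\<forall>e1\<in>E. \<forall>e2\<in>E. smooth_on (\<phi> ` U) (coord_coeff Y U \<phi> \<omega> e1 e2))"
      using two unfolding two_form_def by (rule conjunct2)
    have "b \<in> E'" "c \<in> E'" using that orthonormal_basis_of_subset by blast+
    then show ?thesis by (rule all[rule_format, OF that(1)])
  qed
  have "two_form X (pullback Y f \<omega>)"
    unfolding two_form_def
  proof (intro conjI ballI allI impI)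
    fix x u assume x: "x \<in> points X" and u: "u \<in> tangent_space X x"
    note fx = smooth_mapD(2)[OF f x]
    have sum: "pushforward Y f (\<lambda>g. u g + v g) = (\<lambda>g. pushforward Y f u g + pushforward Y f v g)" for u v
      by (auto simp: pushforward_def)
    show "pullback Y f \<omega> x u u = 0"
      unfolding pullback_def by (rule two_formD(1)[OF two fx push[OF u]])
    fix v w assume v: "v \<in> tangent_space X x" and w: "w \<in> tangent_space X x"
    show "pullback Y f \<omega> x (\<lambda>g. u g + v g) w = pullback Y f \<omega> x u w + pullback Y f \<omega> x v w"
      "pullback Y f \<omega> x w (\<lambda>g. u g + v g) = pullback Y f \<omega> x w u + pullback Y f \<omega> x w v"
      unfolding pullback_def sum
      by (rule two_formD(2)[OF two fx push[OF u] push[OF v] push[OF w]]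
          two_formD(3)[OF two fx push[OF u] push[OF v] push[OF w]])+
  next
    fix x u c w assume x: "x \<in> points X" and u: "u \<in> tangent_space X x" and w: "w \<in> tangent_space X x"
    note fx = smooth_mapD(2)[OF f x]
    have scale: "pushforward Y f (\<lambda>g. c * u g) = (\<lambda>g. c * pushforward Y f u g)" for c u
      by (auto simp: pushforward_def)
    show "pullback Y f \<omega> x (\<lambda>g. c * u g) w = c * pullback Y f \<omega> x u w"
      "pullback Y f \<omega> x w (\<lambda>g. c * u g) = c * pullback Y f \<omega> x w u"
      unfolding pullback_def scale
      by (rule two_formD(4)[OF two fx push[OF u] push[OF w]] two_formD(5)[OF two fx push[OF u] push[OF w]])+
  next
    fix E U \<phi> e1 e2 assume c: "manifold_chart X E U \<phi>" and e: "e1 \<in> E" "e2 \<in> E"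
    show "smooth_on (\<phi> ` U) (coord_coeff X U \<phi> (pullback Y f \<omega>) e1 e2)"
    proof (rule smooth_on_local)
      fix y assume yU: "y \<in> \<phi> ` U"
      then obtain E' V \<psi> B where d: "manifold_chart Y E' V \<psi>" and B: "orthonormal_basis_of B E'"
        and y: "y \<in> \<phi> ` (U \<inter> f -` V)" using charts_at[OF c yU] by (elim exE conjE)
      let ?N = "\<phi> ` (U \<inter> f -` V)"
      note C = manifold_chartD[OF c] and D = manifold_chartD[OF d]
      note F = smooth_map_in_charts[OF X Ys f c d]
      have "smooth_on ?N (pullback_coeff B (coord_coeff Y V \<psi> \<omega>) (\<lambda>z. \<psi> (f (inv_into U \<phi> z))) e1 e2)"
        by (rule smooth_on_pullback_coeff[OF C(1) F(1) D(1,5) F(2,3) B coeff[OF d B] e])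
      then have "smooth_on ?N (coord_coeff X U \<phi> (pullback Y f \<omega>) e1 e2)"
        by (rule smooth_on_cong) (rule coord_coeff_pullback[OF X Ys f two c d B _ e, symmetric])
      moreover have "openin (top_of_set (\<phi> ` U)) ?N"
        by (rule openin_subset_trans[OF F(1)]) (use openin_imp_subset[OF C(5)] in auto)
      ultimately show "\<exists>N. openin (top_of_set (\<phi> ` U)) N \<and> y \<in> N \<and>
          smooth_on N (coord_coeff X U \<phi> (pullback Y f \<omega>) e1 e2)" using y by blast
    qed
  qed
  moreover have "dir_deriv (coord_coeff X U \<phi> (pullback Y f \<omega>) e2 e3) y e1
      - dir_deriv (coord_coeff X U \<phi> (pullback Y f \<omega>) e1 e3) y e2
      + dir_deriv (coord_coeff X U \<phi> (pullback Y f \<omega>) e1 e2) y e3 = 0"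
    if c: "manifold_chart X E U \<phi>" and e: "e1 \<in> E" "e2 \<in> E" "e3 \<in> E" and "y \<in> \<phi> ` U"
    for E U \<phi> e1 e2 e3 y
  proof -
    obtain E' V \<psi> B where d: "manifold_chart Y E' V \<psi>" and B: "orthonormal_basis_of B E'"
      and y: "y \<in> \<phi> ` (U \<inter> f -` V)" using charts_at[OF c \<open>y \<in> \<phi> ` U\<close>] by (elim exE conjE)
    let ?a = "coord_coeff Y V \<psi> \<omega>" and ?F = "\<lambda>z. \<psi> (f (inv_into U \<phi> z))"
    note C = manifold_chartD[OF c] and D = manifold_chartD[OF d]
    note F = smooth_map_in_charts[OF X Ys f c d]
    have BE: "b \<in> E'" if "b \<in> B" for b using that orthonormal_basis_of_subset[OF B] by blast
    have eq: "dir_deriv (coord_coeff X U \<phi> (pullback Y f \<omega>) u v) y w = dir_deriv (pullback_coeff B ?a ?F u v) y w"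
      if "u \<in> E" "v \<in> E" "w \<in> E" for u v w
      by (rule dir_deriv_cong[OF C(1) F(1) y that(3)]) (rule coord_coeff_pullback[OF X Ys f two c d B _ that(1,2)])
    have "dir_deriv (pullback_coeff B ?a ?F e2 e3) y e1 - dir_deriv (pullback_coeff B ?a ?F e1 e3) y e2
        + dir_deriv (pullback_coeff B ?a ?F e1 e2) y e3 = 0"
    proof (rule pullback_coeff_closed[OF C(1) F(1) D(1,5) F(2,3) B coeff[OF d B] _ _ e y])
      fix b c z assume bc: "b \<in> B" "c \<in> B" and "z \<in> \<psi> ` V"
      then obtain x where x: "x \<in> V" "inv_into V \<psi> z = x" using D(4) by force
      have "x \<in> points Y" using x D(3) by blast
      then show "?a b c z = - ?a c b z"
        using two_form_skew[OF two _ coord_vector_tangent[OF Ys d x(1) BE[OF bc(1)]]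
            coord_vector_tangent[OF Ys d x(1) BE[OF bc(2)]]]
        by (simp add: coord_coeff_def x(2))
    next
      fix b c d' z assume bcd: "b \<in> B" "c \<in> B" "d' \<in> B" and z: "z \<in> \<psi> ` V"
      have all: "\<forall>E U \<phi>. manifold_chart Y E U \<phi> \<longrightarrow>
        (\<forall>e1\<in>E. \<forall>e2\<in>E. \<forall>e3\<in>E. \<forall>y\<in>\<phi> ` U.
           dir_deriv (coord_coeff Y U \<phi> \<omega> e2 e3) y e1 - dir_deriv (coord_coeff Y U \<phi> \<omega> e1 e3) y e2
           + dir_deriv (coord_coeff Y U \<phi> \<omega> e1 e2) y e3 = 0)"
        using \<omega> unfolding closed_two_form_def by (rule conjunct2)
      show "dir_deriv (?a c d') z b - dir_deriv (?a b d') z c + dir_deriv (?a b c) z d' = 0"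
        using all[rule_format, OF d BE[OF bcd(1)] BE[OF bcd(2)] BE[OF bcd(3)] z] .
    qed
    then show ?thesis using eq e by simp
  qed
  ultimately show ?thesis unfolding closed_two_form_def by blast
qed


section \<open>Smoothness of the bar construction and its natural maps\<close>

lemma smooth_space_nerve:
  assumes "smooth_space (arrows G)"
  shows smooth_space_nerve2: "smooth_space (nerve2 G)" and smooth_space_nerve3: "smooth_space (nerve3 G)"
  unfolding nerve2_def nerve3_def using assms by (simp_all add: smooth_space_sub_space smooth_space_prod_space)

lemma smooth_space_bar:
  assumes "smooth_space (arrows (VM \<D>))" "smooth_space (arrows (HM \<D>))"
    "smooth_space (arrows (DH \<D>))" "smooth_space (arrows (DV \<D>))"
  shows smooth_space_bar_W2: "smooth_space (bar_W2 \<D>)" and smooth_space_bar_W3: "smooth_space (bar_W3 \<D>)"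
  unfolding bar_W2_def bar_W3_def using assms
  by (simp_all add: smooth_space_sub_space smooth_space_prod_space smooth_space_nerve2 smooth_space_nerve3)

lemma smooth_map_bar_projections:
  assumes "smooth_space (arrows (VM \<D>))" "smooth_space (arrows (HM \<D>))"
    "smooth_space (arrows (DH \<D>))" "smooth_space (arrows (DV \<D>))"
  shows smooth_map_natural_map: "smooth_map (bar_W2 \<D>) (arrows (DH \<D>)) natural_map"
    and smooth_map_bar_W3_DH: "smooth_map (bar_W3 \<D>) (nerve2 (DH \<D>)) (\<lambda>p. fst (snd p))"
    and smooth_map_bar_W3_DV: "smooth_map (bar_W3 \<D>) (nerve2 (DV \<D>)) (\<lambda>p. fst (snd (snd p)))"
proof -
  note s = assms smooth_space_nerve2[OF assms(1)] smooth_space_nerve2[OF assms(2)]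
    smooth_space_nerve2[OF assms(3)] smooth_space_nerve2[OF assms(4)]
    smooth_space_nerve3[OF assms(1)] smooth_space_nerve3[OF assms(2)]
  note p = smooth_space_prod_space
  have nat: "natural_map = (\<lambda>p. fst (snd p))" by (simp add: natural_map_def fun_eq_iff split: prod.splits)
  show "smooth_map (bar_W2 \<D>) (arrows (DH \<D>)) natural_map"
    unfolding bar_W2_def nat
    by (intro smooth_map_from_sub_space smooth_map_compose[OF _ _ smooth_map_snd smooth_map_fst] p s)
  show "smooth_map (bar_W3 \<D>) (nerve2 (DH \<D>)) (\<lambda>p. fst (snd p))"
    unfolding bar_W3_def
    by (intro smooth_map_from_sub_space smooth_map_compose[OF _ _ smooth_map_snd smooth_map_fst] p s)
  show "smooth_map (bar_W3 \<D>) (nerve2 (DV \<D>)) (\<lambda>p. fst (snd (snd p)))"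
    unfolding bar_W3_def
    by (intro smooth_map_from_sub_space smooth_map_compose[OF _ _ smooth_map_snd
          smooth_map_compose[OF _ _ smooth_map_snd smooth_map_fst]] p s)
qed


section \<open>Multiplicativity on the bar construction\<close>

text \<open>Multiplicativity, stated on the space of composable pairs, is transported to any space \<open>W\<close>
  with a smooth map \<open>p\<close> to that space, because pushforward along \<open>p\<close> turns tangent vectors of \<open>W\<close>
  into tangent vectors of composable pairs.\<close>

lemma multiplicative_pullback:
  assumes W: "smooth_space W" and G: "lie_groupoid G" and \<omega>: "multiplicative_two_form G \<omega>"
    and p: "smooth_map W (nerve2 G) p"
    and x: "x \<in> points W" and u: "u \<in> tangent_space W x" and v: "v \<in> tangent_space W x"
  shows "pullback (arrows G) (\<lambda>y. mul G (fst (p y)) (snd (p y))) \<omega> x u v =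
    pullback (arrows G) (\<lambda>y. fst (p y)) \<omega> x u v + pullback (arrows G) (\<lambda>y. snd (p y)) \<omega> x u v"
proof -
  have A: "smooth_space (arrows G)" and mul: "smooth_map (nerve2 G) (arrows G) (\<lambda>(a, b). mul G a b)"
    using G by (simp_all add: lie_groupoid_def manifold_def)
  note N = smooth_space_nerve2[OF A]
  have fst: "smooth_map (nerve2 G) (arrows G) fst" and snd: "smooth_map (nerve2 G) (arrows G) snd"
    unfolding nerve2_def
    by (intro smooth_map_from_sub_space smooth_map_fst smooth_map_snd smooth_space_prod_space A)+
  have pull: "pullback (arrows G) h \<omega> (p x) (pushforward (nerve2 G) p u) (pushforward (nerve2 G) p v)
      = pullback (arrows G) (\<lambda>y. h (p y)) \<omega> x u v" if "smooth_map (nerve2 G) (arrows G) h" for h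
    unfolding pullback_def by (simp add: pushforward_compose[OF N A that])
  show ?thesis
    using \<omega> smooth_mapD(2)[OF p x] pushforward_tangent[OF W N p u] pushforward_tangent[OF W N p v]
      pull[OF mul] pull[OF fst] pull[OF snd]
    unfolding multiplicative_two_form_def by (simp add: case_prod_unfold)
qed

theorem proposition6p2:
  fixes \<D> :: "('d, 'de::euclidean_space, 'v, 've::euclidean_space, 'h, 'he::euclidean_space,
               'm, 'me::euclidean_space) double_groupoid"
    and \<omega> :: "'d two_form"
    and \<Omega> :: "(('v \<times> 'v) \<times> 'd \<times> ('h \<times> 'h)) two_form"
  assumes "presymplectic_double_groupoid \<D> \<omega>"
    and "\<Omega> = pullback (arrows (DH \<D>)) natural_map \<omega>"
  shows "closed_two_form (bar_W2 \<D>) \<Omega> \<and>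
         (\<forall>x\<in>points (bar_W3 \<D>). \<forall>u\<in>tangent_space (bar_W3 \<D>) x. \<forall>v\<in>tangent_space (bar_W3 \<D>) x.
           (\<Sum>i\<in>{0..3}. (-1) ^ i * pullback (bar_W2 \<D>) (bar_face3 \<D> i) \<Omega> x u v) = 0)"
proof (intro conjI ballI)
  let ?D = "arrows (DH \<D>)"
  have double: "double_lie_groupoid \<D>" and closed: "closed_two_form ?D \<omega>"
    and mult: "multiplicative_two_form (DV \<D>) \<omega>" "multiplicative_two_form (DH \<D>) \<omega>"
    using assms(1) by (simp_all add: presymplectic_double_groupoid_def)
  have lie: "lie_groupoid (VM \<D>)" "lie_groupoid (HM \<D>)" "lie_groupoid (DH \<D>)" "lie_groupoid (DV \<D>)"
    and D_eq: "arrows (DV \<D>) = ?D"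
    using double by (simp_all add: double_lie_groupoid_def)
  have D: "manifold ?D" using lie(3) by (simp add: lie_groupoid_def)
  have s: "smooth_space (arrows (VM \<D>))" "smooth_space (arrows (HM \<D>))"
    "smooth_space ?D" "smooth_space (arrows (DV \<D>))"
    using lie by (simp_all add: lie_groupoid_def manifold_def)
  note W2 = smooth_space_bar_W2[OF s] and W3 = smooth_space_bar_W3[OF s]
  note nat = smooth_map_natural_map[OF s]
  show "closed_two_form (bar_W2 \<D>) \<Omega>"
    unfolding assms(2) by (rule closed_two_form_pullback[OF W2 D nat closed])

  fix x u v
  assume x: "x \<in> points (bar_W3 \<D>)" and u: "u \<in> tangent_space (bar_W3 \<D>) x"
    and v: "v \<in> tangent_space (bar_W3 \<D>) x"
  (* The pairs (c, d) = p y and (d, b) = q y, composable for the two products. *)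
  define p q where "p = (\<lambda>y :: ('v \<times> 'v \<times> 'v) \<times> ('d \<times> 'd) \<times> ('d \<times> 'd) \<times> ('h \<times> 'h \<times> 'h). fst (snd y))"
    and "q = (\<lambda>y :: ('v \<times> 'v \<times> 'v) \<times> ('d \<times> 'd) \<times> ('d \<times> 'd) \<times> ('h \<times> 'h \<times> 'h). fst (snd (snd y)))"
  note p = smooth_map_bar_W3_DH[OF s, folded p_def] and q = smooth_map_bar_W3_DV[OF s, folded q_def]
  have face: "pullback (bar_W2 \<D>) (bar_face3 \<D> i) \<Omega> x u v
      = pullback ?D (\<lambda>y. natural_map (bar_face3 \<D> i y)) \<omega> x u v" for i
    unfolding assms(2) pullback_def by (simp add: pushforward_compose[OF W2 s(3) nat])
  have faces: "(\<lambda>y. natural_map (bar_face3 \<D> 0 y)) = (\<lambda>y. snd (q y))"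
    "(\<lambda>y. natural_map (bar_face3 \<D> 1 y)) = (\<lambda>y. mul (DV \<D>) (fst (q y)) (snd (q y)))"
    "(\<lambda>y. natural_map (bar_face3 \<D> 2 y)) = (\<lambda>y. mul (DH \<D>) (fst (p y)) (snd (p y)))"
    "(\<lambda>y. natural_map (bar_face3 \<D> 3 y)) = (\<lambda>y. fst (p y))"
    by (auto simp: fun_eq_iff natural_map_def bar_face3_def hface21_def vface12_def nerve_face2_def p_def q_def)
  have shared: "snd (p y) = fst (q y)" if "y \<in> points (bar_W3 \<D>)" for y
    using that
    by (auto simp: bar_W3_def points_sub_space vface12_def hface21_def nerve_face2_def p_def q_def)
  have snd_p: "smooth_map (bar_W3 \<D>) ?D (\<lambda>y. snd (p y))"
    by (rule smooth_map_compose[OF W3 smooth_space_nerve2[OF s(3)] p])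
       (unfold nerve2_def, intro smooth_map_from_sub_space smooth_map_snd smooth_space_prod_space s)
  have "pullback ?D (\<lambda>y. snd (p y)) \<omega> x u v = pullback ?D (\<lambda>y. fst (q y)) \<omega> x u v"
    unfolding pullback_def
    using shared[OF x] pushforward_cong[OF W3 s(3) snd_p u x shared]
      pushforward_cong[OF W3 s(3) snd_p v x shared] by simp
  moreover have "{0..3} = {0, 1, 2, 3 :: nat}" by auto
  ultimately show "(\<Sum>i\<in>{0..3}. (-1) ^ i * pullback (bar_W2 \<D>) (bar_face3 \<D> i) \<Omega> x u v) = 0"
    using multiplicative_pullback[OF W3 lie(4) mult(1) q x u v] multiplicative_pullback[OF W3 lie(3) mult(2) p x u v]
    unfolding D_eq by (simp add: face faces del: One_nat_def)
qed

end
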